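(* Let $g\ge 0$ be an integer, let $\mu$ and $\nu$ be partitions (not necessarily of the same size), let $s>0$, let $\underline{k}=(k_1,\dots,k_s)$ be a tuple of integers and $\underline{r}=(r_1,\dots,r_s)$ a tuple of positive integers satisfying $$\sum_{i=1}^s (r_i-1)=2g-2+\ell(\mu)+\ell(\nu),\qquad \sum_i\mu_i=\sum_j\nu_j+\sum_l k_l .$$ Let $C(\mu,\nu,\underline{k},\underline{r})$ be the set of $\underline{k}$-leaky tropical covers $\pi\colon\Gamma_1\to\Gamma_2=\mathbb{P}^1_{\mathrm{trop}}$ (up to isomorphism, with $\Gamma_2$ subdivided at fixed points $-\infty<p_1<\dots<p_s<\infty$) satisfying: 1. the ramification profile of $(-\infty,p_1)$ is $\mu$ and of $(p_s,\infty)$ is $\nu$; 2. for each $p_i\in\Gamma_2$ there is a unique vertex $v_i$ of $\Gamma_1$ with $\pi(v_i)=p_i$; write $w_i=\mathrm{val}(v_i)$; 3. $r_i-1=2g(v_i)-2+w_i$ for all $i=1,\dots,s$, and $g=g(\Gamma_1)$. For each vertex $v_i$, denote by $\mathbf{x}_i^-$ (resp. $\mathbf{x}_i^+$) the multiset of weights of incoming (resp. outgoing) edges adjacent to $v_i$, and define the vertex multiplicity $m_{v_i}=(r_i-1)!\,m_{g(v_i)}(\mathbf{x}_i^+,\mathbf{x}_i^-)$. Then $$h^{\underline{k},\underline{r}}_{g;\mu,\nu}=\sum_{\pi\in C(\mu,\nu,\underline{k},\underline{r})}\frac{1}{|\mathrm{Aut}(\pi)|}\prod_{i=1}^s m_{v_i}\prod_{e\in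 E^0(\Gamma_1)}\omega(e).$$
   Context: **Fock space.** Let $\Lambda=\mathbb{C}[p_1,p_2,\dots]$; for $j>0$ let $J_j=j\,\partial/\partial p_j$ and let $J_{-j}$ be multiplication by $p_j$. For an operator $A$ on $\Lambda$, the vacuum expectation $\langle A\rangle$ is the constant term of $A\cdot 1$. Let $\varsigma(u)=2\sinh(u/2)$ and $\mathcal{S}(u)=\varsigma(u)/u$. For $n\in\mathbb{Z}$, $$\mathcal{E}_n(u)=\frac{1}{\varsigma(u)}\sum_{N\ge 0}\frac{1}{N!}\sum_{\substack{j_1,\dots,j_N\in\mathbb{Z}\setminus\{0\}\\ j_1+\dots+j_N=n}}\ \prod_{i=1}^N\frac{\varsigma(j_iu)}{j_i}\ {:}J_{j_1}\cdots J_{j_N}{:}$$ where ${:}\ {:}$ moves all $J_j$ with $j<0$ to the left (the $N=0$ term is $\delta_{n,0}/\varsigma(u)$). For $r\ge 0$, the $k$-leaky $r$-completed cycles operator $\mathcal{F}_r^k$ is $r!$ times the coefficient of $u^r$ in $\mathcal{E}_{-k}(u)$. **Leaky Hurwitz numbers.** The completed cycles $(\underline{k},\underline{r})$-leaky Hurwitz numbers are defined by the vacuum expectation $$h^{\underline{k},\underline{r}}_{g;\mu,\nu}=\frac{1}{\prod_i\mu_i\prod_j\nu_j}\Big\langle\prod_i J_{\mu_i}\prod_{i=1}^s\frac{\mathcal{F}^{k_i}_{r_i}}{r_i}\prod_jJ_{-\nu_j}\Big\rangle .$$ **Vertex factor.** For tuples of positive integers $\mu,\nu$ and $g\ge 0$: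 $m_g(\mu,\nu)=[z^{2g}]\dfrac{\prod_i\mathcal{S}(\mu_iz)\prod_j\mathcal{S}(\nu_jz)}{\mathcal{S}(z)}$. **Tropical covers.** An abstract tropical curve $\Gamma$ is a graph (multiple edges allowed) whose one-valent vertices are called leaves and whose edges adjacent to leaves are called ends; non-leaf vertices are called inner and carry a genus $g(v)\in\mathbb{Z}_{\ge0}$; $E^0(\Gamma)$ is the set of edges that are not ends; edges have lengths, which are infinite exactly for ends, making $\Gamma$ a metric graph. Its genus is $g(\Gamma)=b^1(\Gamma)+\sum_vg(v)$, where $b^1$ is the first Betti number and the sum is over inner vertices. $\mathbb{P}^1_{\mathrm{trop}}=\mathbb{R}\cup\{\pm\infty\}$, subdivided by two-valent vertices $p_1<\dots<p_s$. A leaky tropical cover $\pi\colon\Gamma\to\mathbb{P}^1_{\mathrm{trop}}$ is a map of the geometric realisations sending leaves to $\pm\infty$ and inner vertices to points $p_i$, and affine on each edge $e$ with positive integer slope $\omega(e)$, called the weight of $e$ (an edge may pass over a point $p_i$ at which it has no vertex). An edge at an inner vertex $v$ is incoming if it leaves $v$ in the negative direction and outgoing if it leaves $v$ in the positive direction. The leakiness at $v$ is the sum of the weights of the incoming edges minus the sum of the weights of the outgoing edges; the cover is $\underline{k}$-leaky if the leakiness at the vertex $v_i$ over $p_i$ is $k_i$ for all $i$. The ramification profile of an end of $\mathbb{P}^1_{\mathrm{trop}}$ is the partition formed by the weights of the ends of $\Gamma$ mapping to it. Two covers $\pi_1\colon\Gamma_1\to\mathbb{P}^1_{\mathrm{trop}}$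 and $\pi_2\colon\Gamma_2\to\mathbb{P}^1_{\mathrm{trop}}$ are equivalent if there is an isomorphism of metric graphs $\phi\colon\Gamma_1\to\Gamma_2$ with $\pi_1=\pi_2\circ \phi$; $\mathrm{Aut}(\pi)$ is the group of automorphisms of $\pi$ in this sense.
   Formalization: Leaves are labelled by the parts of μ, ν; covers may be disconnected, with genus b^1+Σg(v)−b_0+1; one-valent inner vertices are allowed; summands are divided by the weights of edges joining two leaves. As written it fails for μ=(2), ν=(1,1), r=(2), k=(0), g=0 (1 vs 1/2). *)

theory Defs
  imports
    Complex_Main
    "HOL-Library.Poly_Mapping"
    "HOL-Library.Multiset"
    "HOL-Library.FuncSet"
    "HOL-Library.Extended_Real"
    "HOL-Computational_Algebra.Formal_Laurent_Series"
begin

section \<open>Fock space\<close>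

text \<open>
  The ring \<open>\<Lambda> = \<complex>[p\<^sub>1, p\<^sub>2, \<dots>]\<close>: a polynomial is a finitely supported function on monomials, a
  monomial a finitely supported function on variables.  The variable \<open>p\<^sub>j\<close> (for \<open>j \<ge> 1\<close>) has
  index \<open>j - 1\<close>.
\<close>

type_synonym fock = "(nat \<Rightarrow>\<^sub>0 nat) \<Rightarrow>\<^sub>0 complex"

definition fock_const :: "complex \<Rightarrow> fock" where
  "fock_const c = Poly_Mapping.single 0 c"

definition fock_var :: "nat \<Rightarrow> fock" where
  "fock_var j = Poly_Mapping.single (Poly_Mapping.single (j - 1) 1) 1"

definition fock_deriv :: "nat \<Rightarrow> fock \<Rightarrow> fock" where
  "fock_deriv j f =
     (\<Sum>m\<in>Poly_Mapping.keys f.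
        Poly_Mapping.single (m - Poly_Mapping.single (j - 1) 1)
          (of_nat (Poly_Mapping.lookup m (j - 1)) * Poly_Mapping.lookup f m))"

text \<open>Only \<open>j \<noteq> 0\<close> is meaningful.\<close>

definition J :: "int \<Rightarrow> fock \<Rightarrow> fock" where
  "J j f = (if j > 0 then of_int j * fock_deriv (nat j) f else fock_var (nat (- j)) * f)"

text \<open>\<open>J_product [j\<^sub>1, \<dots>, j\<^sub>N] = J\<^bsub>j\<^sub>1\<^esub> \<circ> \<dots> \<circ> J\<^bsub>j\<^sub>N\<^esub>\<close>, so the last entry acts first.\<close>

definition J_product :: "int list \<Rightarrow> fock \<Rightarrow> fock" where
  "J_product js = foldr J js"

definition normal_ordered_J :: "int list \<Rightarrow> fock \<Rightarrow> fock" where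
  "normal_ordered_J js = J_product (filter (\<lambda>j. j < 0) js @ filter (\<lambda>j. j > 0) js)"

definition vacuum_expectation :: "(fock \<Rightarrow> fock) \<Rightarrow> complex" where
  "vacuum_expectation A = Poly_Mapping.lookup (A 1) 0"


section \<open>The operators \<open>\<E>\<^sub>n(u)\<close> and the leaky completed cycles operators\<close>

text \<open>\<open>\<varsigma>(u) = 2 sinh (u/2) = e\<^bsup>u/2\<^esup> - e\<^bsup>-u/2\<^esup>\<close>, and \<open>fps_scale a c\<close> is \<open>a(c u)\<close>.\<close>

definition varsigma :: "complex fps" where
  "varsigma = fps_exp (1/2) - fps_exp (- 1/2)"

definition curly_S :: "complex fps" where
  "curly_S = varsigma / fps_X"

definition fps_scale :: "complex fps \<Rightarrow> complex \<Rightarrow> complex fps" where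
  "fps_scale a c = fps_compose a (fps_const c * fps_X)"

definition E_coefficient :: "int list \<Rightarrow> complex fls" where
  "E_coefficient js =
     inverse (fps_to_fls varsigma) *
     (\<Prod>j\<leftarrow>js. fps_to_fls (fps_scale varsigma (of_int j)) / fls_const (of_int j))"

text \<open>
  \<open>E_op n r\<close> is the coefficient of \<open>u\<^sup>r\<close> in \<open>\<E>\<^sub>n(u)\<close>.  The sums over \<open>N\<close> and over
  \<open>N\<close>-tuples are merged into one sum over integer lists.  It is evaluated on a vector
  \<open>v\<close>, where only finitely many summands are non-zero: the positive entries of \<open>js\<close>
  have total at most the weighted degree of \<open>v\<close>, and then \<open>n\<close> fixes the total of the negative ones.
\<close>

definition E_op :: "int \<Rightarrow> int \<Rightarrow> fock \<Rightarrow> fock" where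
  "E_op n r v =
     Sum_any (\<lambda>js. if 0 \<notin> set js \<and> sum_list js = n
       then fock_const (fls_nth (E_coefficient js) r / fact (length js)) * normal_ordered_J js v
       else 0)"

definition F_op :: "int \<Rightarrow> nat \<Rightarrow> fock \<Rightarrow> fock" where
  "F_op k r v = fock_const (fact r) * E_op (- k) (int r) v"

text \<open>\<open>g\<close> is only a label: in the situations of interest it is determined by the other data.\<close>

definition leaky_hurwitz ::
  "nat \<Rightarrow> nat list \<Rightarrow> nat list \<Rightarrow> int list \<Rightarrow> nat list \<Rightarrow> complex" where
  "leaky_hurwitz g \<mu> \<nu> ks rs =
     1 / (of_nat (prod_list \<mu>) * of_nat (prod_list \<nu>)) *
     vacuum_expectation
       (J_product (map int \<mu>)
        \<circ> foldr (\<lambda>(k, r) v. fock_const (1 / of_nat r) * F_op k r v) (zip ks rs)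
        \<circ> J_product (map (\<lambda>n. - int n) \<nu>))"

definition vertex_factor :: "nat \<Rightarrow> nat multiset \<Rightarrow> nat multiset \<Rightarrow> complex" where
  "vertex_factor g A B =
     fps_nth ((\<Prod>a\<in>#A. fps_scale curly_S (of_nat a)) * (\<Prod>b\<in>#B. fps_scale curly_S (of_nat b))
              / curly_S) (2 * g)"

definition is_partition :: "nat list \<Rightarrow> bool" where
  "is_partition \<mu> \<longleftrightarrow> sorted_wrt (\<ge>) \<mu> \<and> (\<forall>m\<in>set \<mu>. 0 < m)"


section \<open>Abstract tropical curves\<close>

text \<open>
  Multigraphs, not necessarily connected; \<open>bd e\<close> is the two-element multiset of endpoints of
  the edge \<open>e\<close>.  Every leaf is one-valent.  A one-valent inner vertex is permitted: the
  operators \<open>\<E>\<^sub>n(u)\<close> contain terms with a single \<open>J\<^sub>j\<close>.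
\<close>

record ('v, 'e) tropical_curve =
  leaves :: "'v set"
  inner :: "'v set"
  edges :: "'e set"
  bd :: "'e \<Rightarrow> 'v multiset"
  len :: "'e \<Rightarrow> ereal"
  vgenus :: "'v \<Rightarrow> nat"

definition vertices :: "('v, 'e, 'z) tropical_curve_scheme \<Rightarrow> 'v set" where
  "vertices \<Gamma> = leaves \<Gamma> \<union> inner \<Gamma>"

definition valence :: "('v, 'e, 'z) tropical_curve_scheme \<Rightarrow> 'v \<Rightarrow> nat" where
  "valence \<Gamma> v = (\<Sum>e\<in>edges \<Gamma>. count (bd \<Gamma> e) v)"

definition ends :: "('v, 'e, 'z) tropical_curve_scheme \<Rightarrow> 'e set" where
  "ends \<Gamma> = {e \<in> edges \<Gamma>. set_mset (bd \<Gamma> e) \<inter> leaves \<Gamma> \<noteq> {}}"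

definition bounded_edges :: "('v, 'e, 'z) tropical_curve_scheme \<Rightarrow> 'e set" where
  "bounded_edges \<Gamma> = edges \<Gamma> - ends \<Gamma>"

text \<open>
  Edges joining two leaves, i.e. components without inner vertex.  In a Hurwitz number a strand of
  weight \<open>w\<close> carries the factor \<open>\<langle>J\<^sub>w J\<^bsub>-w\<^esub>\<rangle> / (w \<cdot> w) = 1/w\<close>, the usual weight of a trivial
  component of degree \<open>w\<close> with its cyclic deck group, which isometries of the strand do not see.
\<close>

definition strands :: "('v, 'e, 'z) tropical_curve_scheme \<Rightarrow> 'e set" where
  "strands \<Gamma> = {e \<in> edges \<Gamma>. set_mset (bd \<Gamma> e) \<subseteq> leaves \<Gamma>}"

definition is_tropical_curve :: "('v, 'e, 'z) tropical_curve_scheme \<Rightarrow> bool" where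
  "is_tropical_curve \<Gamma> \<longleftrightarrow>
     finite (leaves \<Gamma>) \<and> finite (inner \<Gamma>) \<and> finite (edges \<Gamma>) \<and> leaves \<Gamma> \<inter> inner \<Gamma> = {} \<and>
     (\<forall>e\<in>edges \<Gamma>. size (bd \<Gamma> e) = 2 \<and> set_mset (bd \<Gamma> e) \<subseteq> vertices \<Gamma>) \<and>
     (\<forall>v\<in>leaves \<Gamma>. valence \<Gamma> v = 1) \<and>
     (\<forall>e\<in>edges \<Gamma>. 0 < len \<Gamma> e \<and> (len \<Gamma> e = \<infinity> \<longleftrightarrow> e \<in> ends \<Gamma>))"

definition adjacency :: "('v, 'e, 'z) tropical_curve_scheme \<Rightarrow> ('v \<times> 'v) set" where
  "adjacency \<Gamma> = {(u, v). \<exists>e\<in>edges \<Gamma>. bd \<Gamma> e = {#u, v#}}"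

definition num_components :: "('v, 'e, 'z) tropical_curve_scheme \<Rightarrow> nat" where
  "num_components \<Gamma> = card (vertices \<Gamma> // Restr ((adjacency \<Gamma>)\<^sup>*) (vertices \<Gamma>))"

definition first_betti :: "('v, 'e, 'z) tropical_curve_scheme \<Rightarrow> int" where
  "first_betti \<Gamma> =
     int (card (edges \<Gamma>)) - int (card (vertices \<Gamma>)) + int (num_components \<Gamma>)"

text \<open>
  For connected \<open>\<Gamma>\<close> this is \<open>b\<^sup>1(\<Gamma>) + \<Sum>\<^sub>v g(v)\<close>.  In general the usual convention for disconnected
  curves is used, under which \<open>2g - 2\<close> is additive over the components; this is the genus for
  which the Riemann--Hurwitz relation \<open>\<Sum>\<^sub>i (r\<^sub>i - 1) = 2g - 2 + \<ell>(\<mu>) + \<ell>(\<nu>)\<close> holds.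
\<close>

definition curve_genus :: "('v, 'e, 'z) tropical_curve_scheme \<Rightarrow> int" where
  "curve_genus \<Gamma> =
     first_betti \<Gamma> + (\<Sum>v\<in>inner \<Gamma>. int (vgenus \<Gamma> v)) - (int (num_components \<Gamma>) - 1)"


section \<open>Leaky tropical covers\<close>

text \<open>
  \<open>\<P>\<^sup>1\<^sub>t\<^sub>r\<^sub>o\<^sub>p\<close> is \<^typ>\<open>ereal\<close>, subdivided at the entries of a strictly increasing list \<open>ps\<close>.
  A map that is affine on edges is recorded by the images \<open>vmap\<close> of the vertices and by the slopes
  \<open>weight\<close>; an edge of length \<open>l\<close> and slope \<open>w\<close> from \<open>a\<close> to \<open>b\<close> satisfies
  \<open>vmap b - vmap a = w * l\<close>.  This determines the map of geometric realisations; on a strand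
  it does so up to a translation of the strand, which is an isometry.

  As the normalisation of the Hurwitz numbers does not divide by the symmetries of \<open>\<mu>\<close> and \<open>\<nu>\<close>,
  the leaves are labelled: \<open>left_leaves\<close> and \<open>right_leaves\<close> list the leaves
  corresponding to the parts \<open>\<mu>\<^sub>i\<close> and \<open>\<nu>\<^sub>j\<close>, in this order.
\<close>

record ('v, 'e) tropical_cover = "('v, 'e) tropical_curve" +
  vmap :: "'v \<Rightarrow> ereal"
  weight :: "'e \<Rightarrow> nat"
  left_leaves :: "'v list"
  right_leaves :: "'v list"

definition is_tropical_cover :: "real list \<Rightarrow> ('v, 'e) tropical_cover \<Rightarrow> bool" where
  "is_tropical_cover ps \<pi> \<longleftrightarrow>
     is_tropical_curve \<pi> \<and>
     (\<forall>v\<in>leaves \<pi>. vmap \<pi> v \<in> {-\<infinity>, \<infinity>}) \<and>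
     (\<forall>v\<in>inner \<pi>. vmap \<pi> v \<in> ereal ` set ps) \<and>
     (\<forall>e\<in>edges \<pi>. 0 < weight \<pi> e \<and>
        (\<exists>a b. bd \<pi> e = {#a, b#} \<and> vmap \<pi> a < vmap \<pi> b \<and>
               vmap \<pi> b - vmap \<pi> a = ereal (real (weight \<pi> e)) * len \<pi> e))"

definition incoming :: "('v, 'e) tropical_cover \<Rightarrow> 'v \<Rightarrow> 'e set" where
  "incoming \<pi> v = {e \<in> edges \<pi>. \<exists>u. bd \<pi> e = {#u, v#} \<and> vmap \<pi> u < vmap \<pi> v}"

definition outgoing :: "('v, 'e) tropical_cover \<Rightarrow> 'v \<Rightarrow> 'e set" where
  "outgoing \<pi> v = {e \<in> edges \<pi>. \<exists>u. bd \<pi> e = {#v, u#} \<and> vmap \<pi> v < vmap \<pi> u}"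

definition in_weights :: "('v, 'e) tropical_cover \<Rightarrow> 'v \<Rightarrow> nat multiset" where
  "in_weights \<pi> v = image_mset (weight \<pi>) (mset_set (incoming \<pi> v))"

definition out_weights :: "('v, 'e) tropical_cover \<Rightarrow> 'v \<Rightarrow> nat multiset" where
  "out_weights \<pi> v = image_mset (weight \<pi>) (mset_set (outgoing \<pi> v))"

definition leakiness :: "('v, 'e) tropical_cover \<Rightarrow> 'v \<Rightarrow> int" where
  "leakiness \<pi> v = int (sum_mset (in_weights \<pi> v)) - int (sum_mset (out_weights \<pi> v))"

definition vertex_over :: "('v, 'e) tropical_cover \<Rightarrow> real \<Rightarrow> 'v" where
  "vertex_over \<pi> x = (THE v. v \<in> vertices \<pi> \<and> vmap \<pi> v = ereal x)"

text \<open>The ends over \<open>y\<close>, in the order of their leaves \<open>vs\<close>, have weights \<open>\<mu>\<close>.\<close>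

definition has_profile ::
  "('v, 'e) tropical_cover \<Rightarrow> ereal \<Rightarrow> 'v list \<Rightarrow> nat list \<Rightarrow> bool" where
  "has_profile \<pi> y vs \<mu> \<longleftrightarrow>
     distinct vs \<and> set vs = {v \<in> leaves \<pi>. vmap \<pi> v = y} \<and> length vs = length \<mu> \<and>
     (\<forall>i<length \<mu>. \<forall>e\<in>edges \<pi>. vs ! i \<in># bd \<pi> e \<longrightarrow> weight \<pi> e = \<mu> ! i)"

text \<open>
  The covers in \<open>C(\<mu>, \<nu>, k, r)\<close> of genus \<open>g\<close>, before passing to isomorphism classes; the finite
  graphs may be taken to have vertices and edges in \<^typ>\<open>nat\<close>.
\<close>

definition leaky_covers ::
  "real list \<Rightarrow> nat \<Rightarrow> nat list \<Rightarrow> nat list \<Rightarrow> int list \<Rightarrow> nat list \<Rightarrow> (nat, nat) tropical_cover set"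
  where
  "leaky_covers ps g \<mu> \<nu> ks rs = {\<pi>.
     is_tropical_cover ps \<pi> \<and>
     has_profile \<pi> (-\<infinity>) (left_leaves \<pi>) \<mu> \<and>
     has_profile \<pi> \<infinity> (right_leaves \<pi>) \<nu> \<and>
     (\<forall>i<length ps. \<exists>!v. v \<in> vertices \<pi> \<and> vmap \<pi> v = ereal (ps ! i)) \<and>
     (\<forall>i<length ps. leakiness \<pi> (vertex_over \<pi> (ps ! i)) = ks ! i) \<and>
     (\<forall>i<length ps. int (rs ! i) - 1 =
        2 * int (vgenus \<pi> (vertex_over \<pi> (ps ! i))) - 2
        + int (valence \<pi> (vertex_over \<pi> (ps ! i)))) \<and>
     int g = curve_genus \<pi>}"

text \<open>
  Isomorphisms of metric graphs over \<open>\<P>\<^sup>1\<^sub>t\<^sub>r\<^sub>o\<^sub>p\<close>.  Extensionality makes an isomorphism determined by its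
  values on vertices and edges, so that automorphisms can be counted.
\<close>

definition cover_isos ::
  "('v, 'e) tropical_cover \<Rightarrow> ('w, 'f) tropical_cover \<Rightarrow> (('v \<Rightarrow> 'w) \<times> ('e \<Rightarrow> 'f)) set" where
  "cover_isos \<pi> \<pi>' = {(\<phi>, \<psi>).
     \<phi> \<in> extensional (vertices \<pi>) \<and> \<psi> \<in> extensional (edges \<pi>) \<and>
     bij_betw \<phi> (leaves \<pi>) (leaves \<pi>') \<and> bij_betw \<phi> (inner \<pi>) (inner \<pi>') \<and>
     bij_betw \<psi> (edges \<pi>) (edges \<pi>') \<and>
     (\<forall>e\<in>edges \<pi>. bd \<pi>' (\<psi> e) = image_mset \<phi> (bd \<pi> e) \<and> len \<pi>' (\<psi> e) = len \<pi> e) \<and>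
     (\<forall>v\<in>inner \<pi>. vgenus \<pi>' (\<phi> v) = vgenus \<pi> v) \<and>
     (\<forall>v\<in>vertices \<pi>. vmap \<pi>' (\<phi> v) = vmap \<pi> v) \<and>
     (\<forall>e\<in>edges \<pi>. weight \<pi>' (\<psi> e) = weight \<pi> e) \<and>
     left_leaves \<pi>' = map \<phi> (left_leaves \<pi>) \<and>
     right_leaves \<pi>' = map \<phi> (right_leaves \<pi>)}"

definition isomorphic_covers :: "(('v, 'e) tropical_cover \<times> ('v, 'e) tropical_cover) set" where
  "isomorphic_covers = {(\<pi>, \<pi>'). cover_isos \<pi> \<pi>' \<noteq> {}}"

definition Aut :: "('v, 'e) tropical_cover \<Rightarrow> (('v \<Rightarrow> 'v) \<times> ('e \<Rightarrow> 'e)) set" where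
  "Aut \<pi> = cover_isos \<pi> \<pi>"

definition leaky_cover_classes ::
  "real list \<Rightarrow> nat \<Rightarrow> nat list \<Rightarrow> nat list \<Rightarrow> int list \<Rightarrow> nat list \<Rightarrow> (nat, nat) tropical_cover set set"
  where
  "leaky_cover_classes ps g \<mu> \<nu> ks rs =
     leaky_covers ps g \<mu> \<nu> ks rs // Restr isomorphic_covers (leaky_covers ps g \<mu> \<nu> ks rs)"

definition vertex_multiplicity :: "nat \<Rightarrow> ('v, 'e) tropical_cover \<Rightarrow> 'v \<Rightarrow> complex" where
  "vertex_multiplicity r \<pi> v =
     fact (r - 1) * vertex_factor (vgenus \<pi> v) (out_weights \<pi> v) (in_weights \<pi> v)"

end

(*
  Every operator in the vacuum expectation is a sum over pairs (P, Q) of multisets of terms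
  (coefficient) / (P! Q!) * (prod of J_{-j}, j in Q) * (prod of J_j, j in P); for the completed
  cycles operators this comes from grouping the integer tuples (j_1, ..., j_N) by their underlying
  multiset.  Applying the operators from right to left, an annihilator J_j of one operator is paired
  with a creator J_{-j} of an operator further right, which draws an edge of weight j.  By a Vandermonde identity
  for sub-multisets the outcome is the sum over multisets N of triples (left node, right node, weight)
  with coefficient 1 / N!, where N! is the product of the factorials of the multiplicities.

  On the other side, a cover is determined up to isomorphism by its multiset N of edges, because its
  vertices are distinguished by their images and by the labels of the leaves; its automorphisms
  permute equal edges, so there are N! of them.  The genus condition is automatic by counting edges.
*)
theory Submission
  imports Defs "HOL-Combinatorics.Multiset_Permutations"
begin

section \<open>Sub-multisets\<close>

text \<open>A Fock monomial remembers only the weights of the edges that are still open, not the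
  operators that created them, whereas a cover needs both ends of every edge. The Vandermonde
  identity reconciles the two: choosing weights with binomial multiplicity amounts to choosing open
  edges with binomial multiplicity. Integrality of the vertex genus comes from parity. As varsigma(j
  u) / j = u S(j u), a summand with N factors J enters the coefficient of u^r through the
  coefficient of u^(r + 1 - N) in an even power series. It vanishes unless r + 1 - N = 2 h, which
  says r - 1 = 2 h - 2 + N for a vertex of valence N and genus h. The factor (r - 1)! is r! / r.
  Leaves are nodes too, so at first every edge contributes its weight w, ends included. Dividing by
  the parts of mu and nu removes w once per leaf on the edge: a bounded edge keeps w, an end with
  one leaf gets 1, and an edge between two leaves gets 1 / w.\<close>

definition mfact :: "'a multiset \<Rightarrow> nat" where
  "mfact A = (\<Prod>x\<in>set_mset A. fact (count A x))"

lemma mfact_empty [simp]: "mfact {#} = 1"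
  by (simp add: mfact_def)

lemma mfact_superset:
  assumes "finite X" "set_mset A \<subseteq> X"
  shows "mfact A = (\<Prod>x\<in>X. fact (count A x))"
  unfolding mfact_def using assms by (intro prod.mono_neutral_left) (auto simp: not_in_iff)

lemma mfact_add_mset [simp]: "mfact (add_mset x A) = Suc (count A x) * mfact A"
proof -
  have "mfact (add_mset x A) = (\<Prod>y\<in>insert x (set_mset A). (if y = x then Suc (count A x) else 1) * fact (count A y))"
    unfolding mfact_def by (intro prod.cong) auto
  also have "\<dots> = Suc (count A x) * mfact A"
    by (simp add: prod.distrib mfact_superset[of "insert x (set_mset A)" A] subset_insertI del: mult_Suc)
  finally show ?thesis .
qed

lemma mfact_pos [simp]: "mfact A \<noteq> 0"
  by (simp add: mfact_def)

lemma mfact_plus_disjoint: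
  assumes "set_mset A \<inter> set_mset B = {}"
  shows "mfact (A + B) = mfact A * mfact B"
proof -
  have 0: "x \<in># A \<Longrightarrow> count B x = 0" "x \<in># B \<Longrightarrow> count A x = 0" for x
    using assms by (auto simp: disjoint_iff simp flip: not_in_iff)
  have "mfact (A + B) = (\<Prod>x\<in>set_mset A. fact (count (A + B) x)) * (\<Prod>x\<in>set_mset B. fact (count (A + B) x))"
    using assms by (simp add: mfact_def prod.union_disjoint)
  then show ?thesis by (simp add: 0 mfact_def)
qed

lemma mfact_image_inj:
  assumes "inj f"
  shows "mfact (image_mset f A) = mfact A"
proof (induction A)
  case (add x A)
  have "f -` {f x} \<inter> set_mset A = {x} \<inter> set_mset A"
    using assms by (auto simp: inj_def)
  then have "count (image_mset f A) (f x) = count A x"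
    by (cases "x \<in># A") (auto simp: count_image_mset not_in_iff)
  then show ?case using add by simp
qed simp

lemma finite_submultisets [simp]: "finite {S. S \<subseteq># (A :: 'a multiset)}"
proof (rule finite_subset)
  show "{S. S \<subseteq># A} \<subseteq> (\<Union>n\<le>size A. multisets_of_size (set_mset A) n)"
    by (auto simp: multisets_of_size_def dest: mset_subset_eqD size_mset_mono)
qed auto

text \<open>Meaningful only for \<open>S \<subseteq># A\<close>, where it is a product of binomial coefficients.\<close>

definition mbinom :: "'a multiset \<Rightarrow> 'a multiset \<Rightarrow> complex" where
  "mbinom A S = of_nat (mfact A) / (of_nat (mfact S) * of_nat (mfact (A - S)))"

text \<open>Splitting \<open>Suc (count A x)\<close> into the copies of x in S and those in the
  complement R splits the quotient in two. In each half the extra copy of x cancels against the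
  factorial of S or of R, and a count of 0 matches the case where the guard fails.\<close>

lemma mbinom_Pascal:
  assumes "S \<subseteq># add_mset x A"
  shows "mbinom (add_mset x A) S =
    (if x \<in># S then mbinom A (S - {#x#}) else 0) + (if S \<subseteq># A then mbinom A S else 0)"
proof -
  define R where "R = add_mset x A - S"
  have cnt: "Suc (count A x) = count S x + count R x"
    using mset_subset_eq_count[OF assms, of x] by (simp add: R_def)
  have 1: "of_nat (mfact A) * of_nat (count S x) / (of_nat (mfact S) * of_nat (mfact R)) =
      (if x \<in># S then mbinom A (S - {#x#}) else 0 :: complex)"
  proof (cases "x \<in># S")
    case True
    then obtain S' where S': "S = add_mset x S'"
      by (metis mset_add)
    then have "R = A - S'" by (simp add: R_def)
    then show ?thesis using S' by (simp add: mbinom_def divide_simps del: of_nat_Suc mult_Suc)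
  qed (simp add: not_in_iff[THEN iffD1])
  have 2: "of_nat (mfact A) * of_nat (count R x) / (of_nat (mfact S) * of_nat (mfact R)) =
      (if S \<subseteq># A then mbinom A S else 0 :: complex)"
  proof (cases "S \<subseteq># A")
    case True
    then have "R = add_mset x (A - S)"
      by (auto simp: R_def multiset_eq_iff subseteq_mset_def Suc_diff_le)
    then show ?thesis using True by (simp add: mbinom_def divide_simps del: of_nat_Suc mult_Suc)
  next
    case False
    \<comment> \<open>A spare copy of x in R would leave S below A at x, and hence
      everywhere.\<close>
    have "count R x = 0"
    proof (rule ccontr)
      assume "count R x \<noteq> 0"
      then have "count S y \<le> count A y" for y
        using cnt mset_subset_eq_count[OF assms, of y] by (cases "y = x") (simp_all del: count_greater_zero_iff)
      then show False using False by (simp add: subseteq_mset_def)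
    qed
    then show ?thesis using False by simp
  qed
  have "mbinom (add_mset x A) S =
     of_nat (mfact A) * of_nat (Suc (count A x)) / (of_nat (mfact S) * of_nat (mfact R))"
    by (simp add: mbinom_def R_def algebra_simps)
  also have "\<dots> = of_nat (mfact A) * of_nat (count S x) / (of_nat (mfact S) * of_nat (mfact R))
      + of_nat (mfact A) * of_nat (count R x) / (of_nat (mfact S) * of_nat (mfact R))"
    unfolding cnt of_nat_add distrib_left add_divide_distrib ..
  finally show ?thesis by (simp only: 1 2)
qed

text \<open>F takes the binomial as an argument in which it is additive, not as a factor. This
  covers vectors whose coefficient is linear in the binomial without a scalar multiplication on the
  target group.\<close>

lemma sum_mbinom_add_mset:
  fixes F :: "'a multiset \<Rightarrow> complex \<Rightarrow> 'c :: ab_group_add"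
  assumes add: "\<And>S x y. F S (x + y) = F S x + F S y"
  shows "(\<Sum>S | S \<subseteq># add_mset x A. F S (mbinom (add_mset x A) S)) =
    (\<Sum>S | S \<subseteq># A. F S (mbinom A S)) + (\<Sum>S | S \<subseteq># A. F (add_mset x S) (mbinom A S))"
proof -
  have zero: "F S 0 = 0" for S
    using add[of S 0 0] by simp
  have "(\<Sum>S | S \<subseteq># add_mset x A. F S (mbinom (add_mset x A) S)) =
    (\<Sum>S | S \<subseteq># add_mset x A. if S \<subseteq># A then F S (mbinom A S) else 0) +
    (\<Sum>S | S \<subseteq># add_mset x A. if x \<in># S then F S (mbinom A (S - {#x#})) else 0)"
    unfolding sum.distrib[symmetric]
    by (intro sum.cong refl) (auto simp: mbinom_Pascal add zero simp del: subset_mset.le_iff_add)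
  also have "(\<Sum>S | S \<subseteq># add_mset x A. if S \<subseteq># A then F S (mbinom A S) else 0) =
     (\<Sum>S | S \<subseteq># A. F S (mbinom A S))"
    by (rule sum.mono_neutral_cong_right) (auto intro: subset_mset.order_trans[of _ A])
  also have "(\<Sum>S | S \<subseteq># add_mset x A. if x \<in># S then F S (mbinom A (S - {#x#})) else 0) =
     (\<Sum>S | S \<subseteq># add_mset x A \<and> x \<in># S. F S (mbinom A (S - {#x#})))"
    by (rule sum.mono_neutral_cong_right) auto
  also have "\<dots> = (\<Sum>S | S \<subseteq># A. F (add_mset x S) (mbinom A S))"
    by (rule sum.reindex_bij_witness[of _ "add_mset x" "\<lambda>S. S - {#x#}"])
      (auto simp: insert_subset_eq_iff subset_eq_diff_conv)
  finally show ?thesis .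
qed

text \<open>A generalised Vandermonde identity: elements identified by \<open>f\<close> may be chosen separately.\<close>

lemma sum_mbinom_image_mset:
  fixes F :: "'b multiset \<Rightarrow> complex \<Rightarrow> 'c :: ab_group_add"
  assumes "\<And>S x y. F S (x + y) = F S x + F S y"
  shows "(\<Sum>P | P \<subseteq># image_mset f A. F P (mbinom (image_mset f A) P)) =
    (\<Sum>S | S \<subseteq># A. F (image_mset f S) (mbinom A S))"
  using assms
proof (induction A arbitrary: F)
  case (add x A)
  \<comment> \<open>Both sides split by Pascal's rule. The induction hypothesis is used for F and
    for F with \<open>f x\<close> already inserted, which is why F is generalised.\<close>
  then show ?case
    by (simp add: sum_mbinom_add_mset[of F] sum_mbinom_add_mset[of "\<lambda>S. F (image_mset f S)"]
        add.IH[of F] add.IH[of "\<lambda>S. F (add_mset (f x) S)"])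
qed (simp add: mbinom_def)

section \<open>Wick expansion\<close>

definition mexp :: "nat multiset \<Rightarrow> nat \<Rightarrow>\<^sub>0 nat" where
  "mexp m = (\<Sum>j\<in>#m. Poly_Mapping.single (j - 1) 1)"

definition fmon :: "nat multiset \<Rightarrow> complex \<Rightarrow> fock" where
  "fmon m c = Poly_Mapping.single (mexp m) c"

lemma fmon_add: "fmon m (x + y) = fmon m x + fmon m y"
  by (simp add: fmon_def single_add)

lemma fmon_zero [simp]: "fmon m 0 = 0"
  by (simp add: fmon_def)

lemma fock_const_mult_fmon [simp]: "fock_const a * fmon m c = fmon m (a * c)"
  by (simp add: fmon_def fock_const_def mult_single)

lemma mexp_empty [simp]: "mexp {#} = 0"
  and mexp_add_mset [simp]: "mexp (add_mset j m) = Poly_Mapping.single (j - 1) 1 + mexp m"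
  by (simp_all add: mexp_def)

text \<open>Truncated subtraction sends 0 and 1 to the same variable. The condition
  \<open>0 \<notin># m\<close>, which recurs throughout, makes multisets of indices correspond to
  exponent vectors one to one.\<close>

lemma lookup_mexp:
  assumes "0 \<notin># m" "j > 0"
  shows "Poly_Mapping.lookup (mexp m) (j - 1) = count m j"
  using assms by (induction m) (auto simp: lookup_add lookup_single)

lemma mexp_eq_0_iff: "mexp m = 0 \<longleftrightarrow> m = {#}"
proof (cases m)
  case (add x m')
  have "Poly_Mapping.lookup (mexp m) (x - 1) > 0"
    by (simp add: add lookup_add)
  then show ?thesis using add by auto
qed simp

lemma fmon_one: "(1 :: fock) = fmon {#} 1"
  by (simp add: fmon_def)

text \<open>
  The nodes of a cover, numbered \<open>0, \<dots>, M - 1\<close> from left to right; node \<open>a\<close> acts on Fock space by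
  \<open>\<Sum>\<^bsub>P,Q\<^esub> coef a P Q / (P! Q!) \<Prod>\<^bsub>j\<in>Q\<^esub> J\<^bsub>-j\<^esub> \<Prod>\<^bsub>j\<in>P\<^esub> J\<^sub>j\<close>, the sum being over the
  multisets with \<open>R a P Q\<close>.  An edge from \<open>a\<close> to \<open>b\<close> of weight \<open>w\<close> is the triple \<open>(a, b, w)\<close>.
  A pair \<open>(b, w)\<close> is an edge of weight \<open>w\<close> at \<open>b\<close> whose left end is not yet attached; \<open>Op_sum\<close> is
  stated for sums over such configurations only, since locale assumptions are monomorphic.
\<close>

definition out_at :: "(nat \<times> nat \<times> nat) multiset \<Rightarrow> nat \<Rightarrow> nat multiset" where
  "out_at N a = image_mset (snd \<circ> snd) (filter_mset (\<lambda>e. fst e = a) N)"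

definition in_at :: "(nat \<times> nat \<times> nat) multiset \<Rightarrow> nat \<Rightarrow> nat multiset" where
  "in_at N b = image_mset (snd \<circ> snd) (filter_mset (\<lambda>e. fst (snd e) = b) N)"

definition open_at :: "(nat \<times> nat) multiset \<Rightarrow> nat \<Rightarrow> nat multiset" where
  "open_at q b = image_mset snd (filter_mset (\<lambda>e. fst e = b) q)"

lemma out_at_union [simp]: "out_at (A + B) a = out_at A a + out_at B a"
  and in_at_union [simp]: "in_at (A + B) a = in_at A a + in_at B a"
  and open_at_union [simp]: "open_at (p + q) a = open_at p a + open_at q a"
  by (simp_all add: out_at_def in_at_def open_at_def)

lemma multiset_eq_fibre_plus:
  fixes N :: "('a \<times> 'b) multiset"
  shows "filter_mset (\<lambda>e. fst e \<noteq> m) N + image_mset (Pair m) (image_mset snd (filter_mset (\<lambda>e. fst e = m) N)) = N"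
  by (induction N) auto

lemma of_nat_prod_mset_image:
  "(of_nat (\<Prod>x\<in>#A. f x) :: 'b :: comm_semiring_1) = (\<Prod>x\<in>#A. of_nat (f x))"
  by (induction A) simp_all

text \<open>In \<open>Op_fmon\<close> the factor 1 / P! is already absorbed: the product of the J_j
  over P sends the monomial of m to prod P times m! / (m - P)! times that of m - P, and division by
  P! leaves \<open>mbinom m P\<close>. \<open>Op_sum\<close> is confined to finite sums of monomials
  because an operator given by a formal infinite sum is additive only where supports are
  finite.\<close>

locale node_operators =
  fixes M :: nat
    and R :: "nat \<Rightarrow> nat multiset \<Rightarrow> nat multiset \<Rightarrow> bool"
    and coef :: "nat \<Rightarrow> nat multiset \<Rightarrow> nat multiset \<Rightarrow> complex"
    and Op :: "nat \<Rightarrow> fock \<Rightarrow> fock"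
  assumes finite_R: "\<And>a P. a < M \<Longrightarrow> 0 \<notin># P \<Longrightarrow> finite {Q. 0 \<notin># Q \<and> R a P Q}"
    and Op_sum: "\<And>a I m x. a < M \<Longrightarrow> finite (I :: ((nat \<times> nat \<times> nat) multiset \<times> (nat \<times> nat) multiset) set) \<Longrightarrow>
        \<forall>i\<in>I. 0 \<notin># m i \<Longrightarrow> Op a (\<Sum>i\<in>I. fmon (m i) (x i)) = (\<Sum>i\<in>I. Op a (fmon (m i) (x i)))"
    and Op_fmon: "\<And>a m c. a < M \<Longrightarrow> 0 \<notin># m \<Longrightarrow> Op a (fmon m c) =
        (\<Sum>P | P \<subseteq># m. \<Sum>Q | 0 \<notin># Q \<and> R a P Q.
           fmon (m - P + Q) (c * mbinom m P * of_nat (prod_mset P) * coef a P Q / of_nat (mfact Q)))"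
begin

text \<open>States reached once the nodes m, ..., M - 1 have acted: N holds the finished edges, q
  those created but not yet annihilated. The outgoing edges of a node are fixed when it acts, while
  its incoming edges pass from q to N as nodes further left pick them up; hence the second argument
  of R is a sum.\<close>

definition configs :: "nat \<Rightarrow> ((nat \<times> nat \<times> nat) multiset \<times> (nat \<times> nat) multiset) set" where
  "configs m = {(N, q). (\<forall>(a, b, w)\<in>#N. m \<le> a \<and> a < b \<and> b < M \<and> 0 < w) \<and>
     (\<forall>(b, w)\<in>#q. m \<le> b \<and> b < M \<and> 0 < w) \<and>
     (\<forall>a\<in>{m..<M}. R a (out_at N a) (in_at N a + open_at q a))}"

definition config_coef :: "nat \<Rightarrow> (nat \<times> nat \<times> nat) multiset \<times> (nat \<times> nat) multiset \<Rightarrow> complex" where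
  "config_coef m = (\<lambda>(N, q). (\<Prod>a=m..<M. coef a (out_at N a) (in_at N a + open_at q a)) *
     (\<Prod>(a, b, w)\<in>#N. of_nat w) / (of_nat (mfact N) * of_nat (mfact q)))"

text \<open>S consists of the open edges that node m annihilates, which become edges starting at m;
  Q lists the weights of the edges that it creates. \<open>remove_node\<close> can recover S and Q
  because nothing in \<open>configs (Suc m)\<close> is attached to node m.\<close>

definition add_node ::
  "nat \<Rightarrow> ((nat \<times> nat \<times> nat) multiset \<times> (nat \<times> nat) multiset) \<times> (nat \<times> nat) multiset \<times> nat multiset
    \<Rightarrow> (nat \<times> nat \<times> nat) multiset \<times> (nat \<times> nat) multiset" where
  "add_node m = (\<lambda>((N, q), S, Q). (N + image_mset (Pair m) S, q - S + image_mset (Pair m) Q))"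

definition remove_node ::
  "nat \<Rightarrow> (nat \<times> nat \<times> nat) multiset \<times> (nat \<times> nat) multiset
    \<Rightarrow> ((nat \<times> nat \<times> nat) multiset \<times> (nat \<times> nat) multiset) \<times> (nat \<times> nat) multiset \<times> nat multiset" where
  "remove_node m = (\<lambda>(N, q). let S = image_mset snd (filter_mset (\<lambda>e. fst e = m) N) in
     ((filter_mset (\<lambda>e. fst e \<noteq> m) N, filter_mset (\<lambda>e. fst e \<noteq> m) q + S), S,
       image_mset snd (filter_mset (\<lambda>e. fst e = m) q)))"

definition extensions where
  "extensions m = (SIGMA x:configs (Suc m). SIGMA S:{S. S \<subseteq># snd x}. {Q. 0 \<notin># Q \<and> R m (image_mset snd S) Q})"

lemma add_remove: "add_node m (remove_node m y) = y"
  by (cases y) (simp add: add_node_def remove_node_def Let_def multiset_eq_fibre_plus)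

lemma config_facts:
  assumes "(N, q) \<in> configs (Suc m)" "S \<subseteq># q" 
  shows "filter_mset (\<lambda>e. fst e = m) N = {#}" "filter_mset (\<lambda>e. fst e \<noteq> m) N = N"
    "filter_mset (\<lambda>e. fst e = m) (q - S) = {#}" "filter_mset (\<lambda>e. fst e \<noteq> m) (q - S) = q - S"
    "in_at N m = {#}" "open_at q m = {#}"
proof -
  show N: "filter_mset (\<lambda>e. fst e = m) N = {#}" and "in_at N m = {#}" "open_at q m = {#}"
    using assms(1) by (auto simp: configs_def in_at_def open_at_def)
  show q: "filter_mset (\<lambda>e. fst e = m) (q - S) = {#}"
    using assms(1) unfolding filter_mset_eq_mempty_iff by (auto simp: configs_def dest!: in_diffD)
  show "filter_mset (\<lambda>e. fst e \<noteq> m) N = N" "filter_mset (\<lambda>e. fst e \<noteq> m) (q - S) = q - S"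
    using multiset_partition[of N "\<lambda>e. fst e = m"] multiset_partition[of "q - S" "\<lambda>e. fst e = m"]
    unfolding N q by (metis empty_neutral(1))+
qed

lemma remove_add:
  assumes "z \<in> extensions m"
  shows "remove_node m (add_node m z) = z"
proof -
  obtain N q S Q where z: "z = ((N, q), S, Q)" by (metis prod.exhaust)
  with assms have c: "(N, q) \<in> configs (Suc m)" and S: "S \<subseteq># q"
    by (auto simp: extensions_def)
  show ?thesis using S
    by (simp add: z add_node_def remove_node_def Let_def config_facts[OF c S] filter_mset_image_mset
        multiset.map_comp o_def subset_mset.diff_add del: filter_diff_mset subset_mset.add_diff_assoc2 subset_mset.diff_add_assoc2)
qed

lemma open_at_diff_plus:
  assumes "S \<subseteq># q"
  shows "open_at (q - S) a + open_at S a = open_at q a"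
  using assms by (simp flip: open_at_union)

lemma at_Pair:
  "out_at (image_mset (Pair m) S) a = (if a = m then image_mset snd S else {#})"
  "in_at (image_mset (Pair m) S) b = open_at S b"
  "open_at (image_mset (Pair m) Q) b = (if b = m then Q else {#})"
  by (auto simp: out_at_def in_at_def open_at_def filter_mset_image_mset multiset.map_comp o_def)

text \<open>Closing S moves its weights from \<open>open_at\<close> to \<open>in_at\<close>, so the
  total incoming data of the nodes to the right stays the same.\<close>

lemma add_node_at:
  assumes "(N, q) \<in> configs (Suc m)" "S \<subseteq># q" "(N', q') = add_node m ((N, q), S, Q)"
  shows "out_at N' m = image_mset snd S" "in_at N' m + open_at q' m = Q"
    "a > m \<Longrightarrow> out_at N' a = out_at N a" 
    "a > m \<Longrightarrow> in_at N' a + open_at q' a = in_at N a + open_at q a"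
proof -
  have N': "N' = N + image_mset (Pair m) S" and q': "q' = q - S + image_mset (Pair m) Q"
    using assms(3) by (simp_all add: add_node_def)
  have "open_at S m = {#}" "open_at (q - S) m = {#}"
    using open_at_diff_plus[OF assms(2), of m] config_facts(6)[OF assms(1,2)] by auto
  then show "out_at N' m = image_mset snd S" "in_at N' m + open_at q' m = Q"
    using config_facts(1,5)[OF assms(1,2)] by (simp_all add: N' q' at_Pair) (simp add: out_at_def)
  show "a > m \<Longrightarrow> out_at N' a = out_at N a" 
    "a > m \<Longrightarrow> in_at N' a + open_at q' a = in_at N a + open_at q a"
    using open_at_diff_plus[OF assms(2), of a] by (simp_all add: N' q' at_Pair add.commute)
qed

lemma add_node_in_configs:
  assumes "m < M" "z \<in> extensions m"
  shows "add_node m z \<in> configs m"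
proof -
  obtain N q S Q where z: "z = ((N, q), S, Q)" by (metis prod.exhaust)
  with assms have c: "(N, q) \<in> configs (Suc m)" and S: "S \<subseteq># q" and Q: "0 \<notin># Q" "R m (image_mset snd S) Q"
    by (auto simp: extensions_def)
  obtain N' q' where y: "(N', q') = add_node m z" by (metis prod.exhaust)
  note at = add_node_at[OF c S, OF y[unfolded z]]
  have "R a (out_at N' a) (in_at N' a + open_at q' a)" if "a \<in> {m..<M}" for a
  proof (cases "a = m")
    case True
    then show ?thesis using Q at(1,2) by simp
  next
    case False
    then show ?thesis using that at(3,4)[of a] c by (auto simp: configs_def)
  qed
  moreover have "\<forall>(b, w)\<in>#S. m < b \<and> b < M \<and> 0 < w" "\<forall>(b, w)\<in>#q - S. m < b \<and> b < M \<and> 0 < w"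
    using c S by (auto simp: configs_def Suc_le_eq dest!: in_diffD mset_subset_eqD)
  then have "(\<forall>(a, b, w)\<in>#N'. m \<le> a \<and> a < b \<and> b < M \<and> 0 < w)"
     "(\<forall>(b, w)\<in>#q'. m \<le> b \<and> b < M \<and> 0 < w)"
    using c y Q \<open>m < M\<close> by (auto simp: configs_def add_node_def z intro: Suc_leD less_imp_le gr0I)
  ultimately show ?thesis by (simp add: configs_def flip: y)
qed

lemma remove_node_in_extensions:
  assumes "m < M" "y \<in> configs m"
  shows "remove_node m y \<in> extensions m"
proof -
  obtain N' q' where y: "y = (N', q')" by (metis prod.exhaust)
  obtain N q S Q where z: "remove_node m y = ((N, q), S, Q)" by (metis prod.exhaust)
  have N: "N = filter_mset (\<lambda>e. fst e \<noteq> m) N'" and S: "S = image_mset snd (filter_mset (\<lambda>e. fst e = m) N')"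
    and q: "q = filter_mset (\<lambda>e. fst e \<noteq> m) q' + S" and Q: "Q = image_mset snd (filter_mset (\<lambda>e. fst e = m) q')"
    using z by (auto simp: y remove_node_def Let_def)
  have 1: "(\<forall>(a, b, w)\<in>#N. Suc m \<le> a \<and> a < b \<and> b < M \<and> 0 < w)"
     "(\<forall>(b, w)\<in>#q. Suc m \<le> b \<and> b < M \<and> 0 < w)" "0 \<notin># Q"
    using assms(2) by (force simp: N q S Q y configs_def)+
  have N': "N' = N + image_mset (Pair m) S" and q': "q' = filter_mset (\<lambda>e. fst e \<noteq> m) q' + image_mset (Pair m) Q"
    by (simp_all add: N S Q multiset_eq_fibre_plus)
  have R: "R a (out_at N' a) (in_at N' a + open_at q' a)" if "a \<in> {m..<M}" for a
    using assms(2) that by (auto simp: configs_def y)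
  have "out_at N' m = image_mset snd S" by (auto simp: out_at_def S multiset.map_comp)
  moreover have "open_at q' m = Q" by (auto simp: open_at_def Q)
  moreover have "in_at N' m = {#}" using assms(2)
    by (auto simp: y configs_def in_at_def)
  ultimately have 2: "R m (image_mset snd S) Q" using R[of m] assms(1) by simp
  have 3: "R a (out_at N a) (in_at N a + open_at q a)" if "a \<in> {Suc m..<M}" for a
  proof -
    have "open_at q' a = open_at (filter_mset (\<lambda>e. fst e \<noteq> m) q') a"
      using that by (subst q') (simp add: at_Pair)
    then have "out_at N' a = out_at N a" "in_at N' a + open_at q' a = in_at N a + open_at q a"
      using that by (simp_all add: N' at_Pair q add.commute)
    then show ?thesis using R[of a] that by simp
  qed
  show ?thesis
    unfolding z extensions_def using 1 2 3 by (simp add: configs_def q)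
qed

text \<open>\<open>mbinom q S\<close> turns 1 / q! into 1 / (S! (q - S)!). New edges start at m and
  old ones do not, so N'! = N! S!; likewise q'! = (q - S)! Q!.\<close>

lemma config_coef_add_node:
  assumes "m < M" "z \<in> extensions m" "z = (x, S, Q)"
  shows "config_coef m (add_node m z) =
    config_coef (Suc m) x * mbinom (snd x) S * of_nat (prod_mset (image_mset snd S)) * coef m (image_mset snd S) Q / of_nat (mfact Q)"
proof -
  obtain N q where x: "x = (N, q)" by (metis prod.exhaust)
  have c: "(N, q) \<in> configs (Suc m)" and S: "S \<subseteq># q"
    using assms by (auto simp: extensions_def x)
  obtain N' q' where y: "(N', q') = add_node m z" by (metis prod.exhaust)
  note at = add_node_at[OF c S, OF y[unfolded assms(3) x]]
  have N': "N' = N + image_mset (Pair m) S" and q': "q' = q - S + image_mset (Pair m) Q"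
    using y by (simp_all add: assms(3) x add_node_def)
  have "mfact N' = mfact N * mfact S"
    unfolding N' using config_facts(1)[OF c S]
    by (subst mfact_plus_disjoint) (auto simp: mfact_image_inj inj_def simp del: filter_diff_mset)
  moreover have "mfact q' = mfact (q - S) * mfact Q"
    unfolding q' using config_facts(3)[OF c S]
    by (subst mfact_plus_disjoint) (auto simp: mfact_image_inj inj_def simp del: filter_diff_mset)
  moreover have "(\<Prod>(a, b, w)\<in>#N'. of_nat w :: complex) = (\<Prod>(a, b, w)\<in>#N. of_nat w) * of_nat (prod_mset (image_mset snd S))"
    by (simp add: N' multiset.map_comp o_def case_prod_unfold of_nat_prod_mset_image)
  moreover have "(\<Prod>a=m..<M. coef a (out_at N' a) (in_at N' a + open_at q' a)) =
      coef m (image_mset snd S) Q * (\<Prod>a=Suc m..<M. coef a (out_at N a) (in_at N a + open_at q a))"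
    using assms(1) at by (simp add: prod.atLeast_Suc_lessThan)
  ultimately show ?thesis
    unfolding y[symmetric] by (simp add: config_coef_def x mbinom_def divide_simps)
qed

lemma finite_extensions:
  assumes "m < M" "finite (configs (Suc m))"
  shows "finite (extensions m)"
proof -
  have "finite {Q. 0 \<notin># Q \<and> R m (image_mset snd S) Q}" if "x \<in> configs (Suc m)" "S \<subseteq># snd x" for x S
    using that by (intro finite_R[OF assms(1)]) (force simp: configs_def dest: mset_subset_eqD)
  then show ?thesis unfolding extensions_def
    by (intro finite_SigmaI assms) auto
qed

lemma bij_add_node:
  assumes "m < M"
  shows "bij_betw (add_node m) (extensions m) (configs m)"
  by (rule bij_betw_byWitness[where f' = "remove_node m"])
    (use assms in \<open>auto simp: add_remove remove_add add_node_in_configs remove_node_in_extensions\<close>)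

lemma configs_M: "configs M = {({#}, {#})}"
proof -
  have "N = {#} \<and> q = {#}" if "(N, q) \<in> configs M" for N q
  proof -
    have "\<forall>x\<in>#N. False" "\<forall>x\<in>#q. False" using that by (auto simp: configs_def)
    then show ?thesis by (auto simp: multiset_eq_iff not_in_iff)
  qed
  then show ?thesis by (auto simp: configs_def)
qed

lemma finite_configs: "m \<le> M \<Longrightarrow> finite (configs m)"
proof (induction rule: inc_induct)
  case base
  then show ?case by (simp add: configs_M)
next
  case (step m)
  then show ?case using bij_betw_finite[OF bij_add_node] finite_extensions by blast
qed

text \<open>Different configurations may have the same monomial. The sum stays indexed by
  configurations all the same, so that the next node can be told which open edges it closes.\<close>

lemma foldr_Op:
  assumes "m \<le> M"
  shows "foldr Op [m..<M] 1 = (\<Sum>y\<in>configs m. fmon (image_mset snd (snd y)) (config_coef m y))"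
  using assms
proof (induction rule: inc_induct)
  case base
  then show ?case by (simp add: configs_M config_coef_def fmon_one)
next
  case (step m)
  have fin: "finite (configs (Suc m))" using step finite_configs by simp
  have pos: "0 \<notin># image_mset snd (snd x)" if "x \<in> configs (Suc m)" for x
    using that by (force simp: configs_def)
  define G where "G x S Q = fmon (image_mset snd (snd x - S) + Q)
     (config_coef (Suc m) x * mbinom (snd x) S * of_nat (prod_mset (image_mset snd S)) * coef m (image_mset snd S) Q / of_nat (mfact Q))"
    for x S Q
  have "foldr Op [m..<M] 1 = Op m (foldr Op [Suc m..<M] 1)"
    using step by (simp add: upt_conv_Cons)
  also have "\<dots> = (\<Sum>x\<in>configs (Suc m). Op m (fmon (image_mset snd (snd x)) (config_coef (Suc m) x)))"
    unfolding step.IH using step.hyps pos by (intro Op_sum fin) auto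
  also have "\<dots> = (\<Sum>x\<in>configs (Suc m). \<Sum>S | S \<subseteq># snd x. \<Sum>Q | 0 \<notin># Q \<and> R m (image_mset snd S) Q. G x S Q)"
  proof (rule sum.cong[OF refl])
    fix x assume x: "x \<in> configs (Suc m)"
    let ?p = "image_mset snd (snd x)"
    define F where "F P c = (\<Sum>Q | 0 \<notin># Q \<and> R m P Q. fmon (?p - P + Q)
       (config_coef (Suc m) x * c * of_nat (prod_mset P) * coef m P Q / of_nat (mfact Q)))" for P c
    have F_add: "F P (c + d) = F P c + F P d" for P c d
      unfolding F_def sum.distrib[symmetric] fmon_add[symmetric]
      by (simp add: algebra_simps add_divide_distrib)
    have "Op m (fmon ?p (config_coef (Suc m) x)) = (\<Sum>P | P \<subseteq># ?p. F P (mbinom ?p P))"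
      using step.hyps pos[OF x] by (simp add: Op_fmon F_def)
    \<comment> \<open>\<open>Op_fmon\<close> selects weights from the monomial; the Vandermonde
      identity replaces this by a selection of open edges, whose right ends the monomial has
      forgotten.\<close>
    also have "\<dots> = (\<Sum>S | S \<subseteq># snd x. F (image_mset snd S) (mbinom (snd x) S))"
      by (rule sum_mbinom_image_mset) (rule F_add)
    also have "\<dots> = (\<Sum>S | S \<subseteq># snd x. \<Sum>Q | 0 \<notin># Q \<and> R m (image_mset snd S) Q. G x S Q)"
      by (simp add: F_def G_def image_mset_Diff)
    finally show "Op m (fmon ?p (config_coef (Suc m) x)) = \<dots>" .
  qed
  also have "\<dots> = (\<Sum>(x, S, Q)\<in>extensions m. G x S Q)"
  proof -
    have fin': "finite {Q. 0 \<notin># Q \<and> R m (image_mset snd S) Q}" if "x \<in> configs (Suc m)" "S \<subseteq># snd x" for x S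
      using that by (intro finite_R step) (force simp: configs_def dest: mset_subset_eqD)
    then have "(\<Sum>x\<in>configs (Suc m). \<Sum>S | S \<subseteq># snd x. \<Sum>Q | 0 \<notin># Q \<and> R m (image_mset snd S) Q. G x S Q) =
      (\<Sum>x\<in>configs (Suc m). \<Sum>(S, Q)\<in>(SIGMA S:{S. S \<subseteq># snd x}. {Q. 0 \<notin># Q \<and> R m (image_mset snd S) Q}). G x S Q)"
      using fin' by (intro sum.cong refl sum.Sigma) auto
    also have "\<dots> = (\<Sum>(x, S, Q)\<in>extensions m. G x S Q)"
      unfolding extensions_def using fin fin'
      by (intro sum.Sigma ballI finite_SigmaI) auto
    finally show ?thesis .
  qed
  also have "\<dots> = (\<Sum>z\<in>extensions m. fmon (image_mset snd (snd (add_node m z))) (config_coef m (add_node m z)))"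
  proof (rule sum.cong[OF refl], clarify)
    fix N q S Q assume z: "((N, q), S, Q) \<in> extensions m"
    show "G (N, q) S Q = fmon (image_mset snd (snd (add_node m ((N, q), S, Q)))) (config_coef m (add_node m ((N, q), S, Q)))"
      unfolding config_coef_add_node[OF step.hyps(2) z refl] G_def
      by (simp add: add_node_def multiset.map_comp o_def)
  qed
  also have "\<dots> = (\<Sum>y\<in>configs m. fmon (image_mset snd (snd y)) (config_coef m y))"
    by (rule sum.reindex_bij_betw) (rule bij_add_node[OF step.hyps(2)])
  finally show ?case .
qed

definition closed_configs :: "(nat \<times> nat \<times> nat) multiset set" where
  "closed_configs = {N. (\<forall>(a, b, w)\<in>#N. a < b \<and> b < M \<and> 0 < w) \<and> (\<forall>a<M. R a (out_at N a) (in_at N a))}"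

text \<open>The constant term keeps exactly the configurations without open edges.\<close>

theorem vacuum_expectation_foldr_Op:
  "vacuum_expectation (foldr Op [0..<M]) =
    (\<Sum>N\<in>closed_configs. (\<Prod>a<M. coef a (out_at N a) (in_at N a)) * (\<Prod>(a, b, w)\<in>#N. of_nat w) / of_nat (mfact N))"
proof -
  have "vacuum_expectation (foldr Op [0..<M]) =
     (\<Sum>y\<in>configs 0. if snd y = {#} then config_coef 0 y else 0)"
    unfolding vacuum_expectation_def foldr_Op[OF le0] lookup_sum
    by (simp add: fmon_def lookup_single mexp_eq_0_iff when_def)
  also have "\<dots> = (\<Sum>y\<in>{y\<in>configs 0. snd y = {#}}. config_coef 0 y)"
    by (simp add: sum.inter_filter finite_configs)
  also have "\<dots> = (\<Sum>N\<in>closed_configs. config_coef 0 (N, {#}))"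
    by (rule sum.reindex_bij_witness[of _ "\<lambda>N. (N, {#})" fst])
      (auto simp: configs_def closed_configs_def open_at_def)
  finally show ?thesis
    by (simp add: config_coef_def open_at_def atLeast0LessThan)
qed

end

section \<open>The completed cycles operators\<close>

lemma fps_scale_nth [simp]: "fps_scale a c $ n = c ^ n * a $ n"
  by (simp add: fps_scale_def)

lemma fps_scale_mult: "fps_scale (a * b) c = fps_scale a c * fps_scale b c"
  by (simp add: fps_scale_def fps_compose_mult_distrib)

lemma varsigma_nth_even: "even n \<Longrightarrow> varsigma $ n = 0"
  by (simp add: varsigma_def power_minus_even)

lemma curly_S_nth: "curly_S $ n = varsigma $ Suc n"
  by (simp add: curly_S_def fps_divide_X)

lemma curly_S_nth_odd: "odd n \<Longrightarrow> curly_S $ n = 0"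
  by (simp add: curly_S_nth varsigma_nth_even)

lemma curly_S_nth_0 [simp]: "curly_S $ 0 = 1"
  by (simp add: curly_S_nth varsigma_def)

lemma varsigma_eq: "varsigma = fps_X * curly_S"
proof (rule fps_ext)
  show "varsigma $ n = (fps_X * curly_S) $ n" for n
    by (cases n) (simp_all add: curly_S_nth varsigma_nth_even)
qed

lemma fps_scale_varsigma: "fps_scale varsigma c = fps_const c * (fps_X * fps_scale curly_S c)"
proof (rule fps_ext)
  show "fps_scale varsigma c $ n = (fps_const c * (fps_X * fps_scale curly_S c)) $ n" for n
    by (cases n) (simp_all add: curly_S_nth varsigma_nth_even)
qed

lemma fps_scale_curly_S_uminus: "fps_scale curly_S (- c) = fps_scale curly_S c"
proof (rule fps_ext)
  show "fps_scale curly_S (- c) $ n = fps_scale curly_S c $ n" for n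
    by (cases "even n") (simp_all add: curly_S_nth_odd)
qed

definition vertex_series :: "nat multiset \<Rightarrow> nat multiset \<Rightarrow> complex fps" where
  "vertex_series A B = (\<Prod>a\<in>#A. fps_scale curly_S (of_nat a)) * (\<Prod>b\<in>#B. fps_scale curly_S (of_nat b)) / curly_S"

lemma vertex_series_mult:
  "vertex_series A B * curly_S = (\<Prod>a\<in>#A. fps_scale curly_S (of_nat a)) * (\<Prod>b\<in>#B. fps_scale curly_S (of_nat b))"
  by (simp add: vertex_series_def fps_divide_unit mult.assoc inverse_mult_eq_1)

lemma fps_scale_prod_curly_S:
  "fps_scale (\<Prod>a\<in>#A. fps_scale curly_S (f a)) (- 1) = (\<Prod>a\<in>#A. fps_scale curly_S (f a))"
proof (induction A)
  case empty
  show ?case by (rule fps_ext) simp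
next
  case (add a A)
  have "fps_scale (fps_scale curly_S (f a)) (- 1) = fps_scale curly_S (f a)"
  proof (rule fps_ext)
    show "fps_scale (fps_scale curly_S (f a)) (- 1) $ n = fps_scale curly_S (f a) $ n" for n
      by (cases "even n") (simp_all add: curly_S_nth_odd)
  qed
  then show ?case by (simp add: fps_scale_mult add)
qed

text \<open>The substitution u -> -u fixes S(u) and every S(a u), hence both sides of
  \<open>vertex_series_mult\<close>. Cancelling the nonzero factor \<open>curly_S\<close> shows that
  the quotient is even.\<close>

lemma vertex_series_nth_odd:
  assumes "odd n"
  shows "vertex_series A B $ n = 0"
proof -
  have "fps_scale (vertex_series A B) (- 1) * fps_scale curly_S (- 1) = vertex_series A B * curly_S"
    unfolding fps_scale_mult[symmetric] vertex_series_mult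
    by (simp add: fps_scale_mult fps_scale_prod_curly_S)
  moreover have "fps_scale curly_S (- 1) = curly_S"
    by (rule fps_ext) (simp add: fps_scale_curly_S_uminus)
  moreover have "curly_S \<noteq> 0"
    by (metis curly_S_nth_0 fps_zero_nth zero_neq_one)
  ultimately have "fps_scale (vertex_series A B) (- 1) = vertex_series A B"
    by simp
  then have "fps_scale (vertex_series A B) (- 1) $ n = vertex_series A B $ n"
    by simp
  with assms show ?thesis by simp
qed

section \<open>Integer tuples as pairs of multisets of positive integers\<close>

definition pos_part :: "int list \<Rightarrow> nat multiset" where
  "pos_part js = image_mset nat (filter_mset (\<lambda>j. 0 < j) (mset js))"

definition neg_part :: "int list \<Rightarrow> nat multiset" where
  "neg_part js = image_mset (\<lambda>j. nat (- j)) (filter_mset (\<lambda>j. j < 0) (mset js))"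

lemma pos_part_simps [simp]:
  "pos_part [] = {#}" "pos_part (j # js) = (if 0 < j then add_mset (nat j) (pos_part js) else pos_part js)"
  by (simp_all add: pos_part_def)

lemma neg_part_simps [simp]:
  "neg_part [] = {#}" "neg_part (j # js) = (if j < 0 then add_mset (nat (- j)) (neg_part js) else neg_part js)"
  by (simp_all add: neg_part_def)

lemma zero_notin_parts [simp]: "0 \<notin># pos_part js" "0 \<notin># neg_part js"
  by (auto simp: pos_part_def neg_part_def)

lemma size_parts: "0 \<notin> set js \<Longrightarrow> size (pos_part js) + size (neg_part js) = length js"
  by (induction js) auto

lemma sum_parts: "int (sum_mset (pos_part js)) - int (sum_mset (neg_part js)) = sum_list js"
  by (induction js) auto

definition signed_parts :: "nat multiset \<Rightarrow> nat multiset \<Rightarrow> int multiset" where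
  "signed_parts P Q = image_mset int P + image_mset (\<lambda>n. - int n) Q"

lemma signed_parts_parts: "0 \<notin> set js \<Longrightarrow> signed_parts (pos_part js) (neg_part js) = mset js"
  unfolding signed_parts_def by (induction js) auto

lemma parts_signed_parts:
  assumes "mset js = signed_parts P Q" "0 \<notin># P" "0 \<notin># Q"
  shows "0 \<notin> set js" "pos_part js = P" "neg_part js = Q"
proof -
  have "filter_mset (\<lambda>j. 0 < j) (image_mset int P) = image_mset int P"
    "filter_mset (\<lambda>j. j < 0) (image_mset (\<lambda>n. - int n) Q) = image_mset (\<lambda>n. - int n) Q"
    "filter_mset (\<lambda>j. j < 0) (image_mset int P) = {#}"
    "filter_mset (\<lambda>j. 0 < j) (image_mset (\<lambda>n. - int n) Q) = {#}"
    using assms(2,3) by (induction P, auto) (induction Q, auto)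
  then show "pos_part js = P" "neg_part js = Q"
    by (simp_all add: pos_part_def neg_part_def assms(1) signed_parts_def multiset.map_comp o_def)
  have "0 \<notin># mset js" using assms by (auto simp: signed_parts_def)
  then show "0 \<notin> set js" by simp
qed

text \<open>Only 0 could occur in both images, and it is excluded from P.\<close>

lemma mfact_signed_parts:
  assumes "0 \<notin># P"
  shows "mfact (signed_parts P Q) = mfact P * mfact Q"
proof -
  have zero: "a = 0" if "int a = - int b" for a b using that by linarith
  then have "set_mset (image_mset int P) \<inter> set_mset (image_mset (\<lambda>n. - int n) Q) = {}"
    using assms by (auto dest: zero)
  then show ?thesis
    by (simp add: signed_parts_def mfact_plus_disjoint mfact_image_inj inj_def)
qed

text \<open>Each varsigma(j u) / j equals u S(j u), and 1 / varsigma(u) equals u^(-1) / S(u). A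
  tuple of length N therefore carries u^(N - 1) times its vertex series, which shifts the index r to
  r + 1 - N.\<close>

lemma E_coefficient_nth:
  assumes "0 \<notin> set js"
  shows "fls_nth (E_coefficient js) (int r) =
    (if length js \<le> r + 1 then vertex_series (pos_part js) (neg_part js) $ (r + 1 - length js) else 0)"
proof -
  let ?H = "vertex_series (pos_part js) (neg_part js)"
  have "(\<Prod>j\<leftarrow>js. fps_to_fls (fps_scale varsigma (of_int j)) / fls_const (of_int j)) =
      fls_X ^ length js * fps_to_fls ((\<Prod>a\<in>#pos_part js. fps_scale curly_S (of_nat a)) *
        (\<Prod>b\<in>#neg_part js. fps_scale curly_S (of_nat b)))"
    using assms
  proof (induction js)
    case (Cons j js)
    have "fps_to_fls (fps_scale varsigma (of_int j)) / fls_const (of_int j) = fls_X * fps_to_fls (fps_scale curly_S (of_int j))"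
      using Cons.prems by (simp add: fps_scale_varsigma fls_times_fps_to_fls)
    \<comment> \<open>S is even, so a negative index may be replaced by the absolute value kept in
      \<open>neg_part\<close>.\<close>
    moreover have "fps_scale curly_S (of_int j) = fps_scale curly_S (of_nat (nat (- j)))" if "j < 0"
      using that fps_scale_curly_S_uminus[of "of_int j"] by simp
    ultimately show ?case
      using Cons by (auto simp: fls_times_fps_to_fls mult_ac neq_iff)
  qed simp
  also have "\<dots> = fls_X ^ length js * (fps_to_fls ?H * fps_to_fls curly_S)"
    by (simp add: vertex_series_mult[symmetric] fls_times_fps_to_fls)
  finally have "E_coefficient js = inverse (fls_X * fps_to_fls curly_S) * (fls_X ^ length js * (fps_to_fls ?H * fps_to_fls curly_S))"
    by (simp add: E_coefficient_def varsigma_eq fls_times_fps_to_fls)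
  moreover have "curly_S \<noteq> 0"
    by (metis curly_S_nth_0 fps_zero_nth zero_neq_one)
  ultimately have "E_coefficient js = fls_X_inv * (fls_X ^ length js * fps_to_fls ?H)"
    by (simp add: fls_inverse_X fls_X_inv_times_conv_shift field_simps)
  then show ?thesis
    by (auto simp: fls_X_inv_times_conv_shift fls_X_power_times_conv_shift nat_diff_distrib' nat_add_distrib
        intro!: arg_cong[of _ _ "\<lambda>n. ?H $ n"])
qed

section \<open>Action of the operators J on monomials\<close>

lemma fock_deriv_superset:
  assumes "finite K" "Poly_Mapping.keys f \<subseteq> K"
  shows "fock_deriv j f = (\<Sum>m\<in>K. Poly_Mapping.single (m - Poly_Mapping.single (j - 1) 1)
          (of_nat (Poly_Mapping.lookup m (j - 1)) * Poly_Mapping.lookup f m))"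
  unfolding fock_deriv_def using assms
  by (intro sum.mono_neutral_left) (auto simp: in_keys_iff)

lemma fock_deriv_add: "fock_deriv j (f + g) = fock_deriv j f + fock_deriv j g"
proof -
  let ?K = "Poly_Mapping.keys f \<union> Poly_Mapping.keys g"
  show ?thesis
    using Poly_Mapping.keys_add[of f g]
    by (simp add: fock_deriv_superset[of ?K] lookup_add distrib_left single_add sum.distrib)
qed

lemma J_add: "J j (v + w) = J j v + J j w"
  by (simp add: J_def fock_deriv_add distrib_left)

lemma J_zero [simp]: "J j 0 = 0"
  using J_add[of j 0 0] by simp

lemma J_sum: "J j (\<Sum>i\<in>I. v i) = (\<Sum>i\<in>I. J j (v i))"
  by (induction I rule: infinite_finite_induct) (simp_all add: J_add)

lemma J_product_sum: "J_product js (\<Sum>i\<in>I. v i) = (\<Sum>i\<in>I. J_product js (v i))"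
  by (induction js) (simp_all add: J_product_def J_sum)

lemma J_neg_fmon: "0 < j \<Longrightarrow> J (- int j) (fmon m c) = fmon (add_mset j m) c"
  by (simp add: J_def fock_var_def fmon_def mult_single)

lemma mexp_minus: "j \<in># m \<Longrightarrow> mexp m - Poly_Mapping.single (j - 1) 1 = mexp (m - {#j#})"
  by (metis add_diff_cancel_left' mexp_add_mset insert_DiffM)

lemma of_nat_mult_fock_single:
  "of_nat c * Poly_Mapping.single k x = (Poly_Mapping.single k (of_nat c * x) :: fock)"
  by (simp add: mult_single flip: single_of_nat)

lemma J_pos_fmon:
  assumes "0 < j" "0 \<notin># m"
  shows "J (int j) (fmon m c) = fmon (m - {#j#}) (of_nat (count m j) * of_nat j * c)"
proof -
  have deriv: "fock_deriv j (fmon m c) = Poly_Mapping.single (mexp m - Poly_Mapping.single (j - 1) 1) (of_nat (count m j) * c)"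
    using lookup_mexp[OF assms(2,1)] by (simp add: fock_deriv_superset[of "{mexp m}"] fmon_def)
  \<comment> \<open>For j not in m both coefficients vanish, so the exponents need not be
    compared.\<close>
  have *: "Poly_Mapping.single (mexp m - Poly_Mapping.single (j - 1) 1) (of_nat (count m j) * d) = fmon (m - {#j#}) (of_nat (count m j) * d)" for d
    using mexp_minus[of j m] by (cases "j \<in># m") (simp_all add: fmon_def not_in_iff)
  have "J (int j) (fmon m c) = of_int (int j) * fock_deriv j (fmon m c)"
    using assms by (simp add: J_def)
  with deriv have "J (int j) (fmon m c) = Poly_Mapping.single (mexp m - Poly_Mapping.single (j - 1) 1) (of_nat (count m j) * (of_nat j * c))"
    by (simp only: of_nat_mult_fock_single of_int_of_nat_eq mult.left_commute)
  with * show ?thesis by (simp only: mult.assoc)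
qed

lemma J_product_neg_fmon:
  "J_product (filter (\<lambda>j. j < 0) js) (fmon m c) = fmon (m + neg_part js) c"
proof (induction js)
  case (Cons j js)
  then show ?case using J_neg_fmon[of "nat (- j)"] by (auto simp: J_product_def)
qed (simp add: J_product_def)

lemma add_mset_subseteq_iff_in_diff:
  assumes "P \<subseteq># m"
  shows "add_mset x P \<subseteq># m \<longleftrightarrow> x \<in># m - P"
proof -
  obtain R where "m = P + R" using assms by (metis mset_subset_eq_exists_conv)
  moreover have "P + {#x#} \<subseteq># P + R \<longleftrightarrow> {#x#} \<subseteq># R" by (rule subset_mset.add_le_cancel_left)
  ultimately show ?thesis by simp
qed

text \<open>Removing the entries one at a time multiplies the successive multiplicities
  \<open>count (m - P) i\<close>, giving m! / (m - P)!. This is written as \<open>mbinom m P\<close>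
  times P! because the P! cancels later against the number of orderings.\<close>

lemma J_product_pos_fmon:
  assumes "0 \<notin># m"
  shows "J_product (filter (\<lambda>j. 0 < j) js) (fmon m c) =
    (if pos_part js \<subseteq># m
     then fmon (m - pos_part js) (c * mbinom m (pos_part js) * of_nat (mfact (pos_part js)) * of_nat (prod_mset (pos_part js)))
     else 0)"
proof (induction js)
  case (Cons j js)
  show ?case
  proof (cases "0 < j")
    case True
    define P where "P = pos_part js"
    define i where "i = nat j"
    have i: "0 < i" "int i = j" using True by (simp_all add: i_def)
    note IH = Cons.IH[folded P_def]
    show ?thesis
    proof (cases "P \<subseteq># m")
      case P: True
      have m: "0 \<notin># m - P" using assms by (auto dest: in_diffD)
      have step: "J_product (filter (\<lambda>j. 0 < j) (j # js)) (fmon m c) = fmon (m - P - {#i#})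
         (of_nat (count (m - P) i) * of_nat i * (c * mbinom m P * of_nat (mfact P) * of_nat (prod_mset P)))"
        using P True IH J_pos_fmon[OF i(1) m] by (simp add: J_product_def i(2))
      show ?thesis
      proof (cases "i \<in># m - P")
        case in_m: True
        then have sub: "add_mset i P \<subseteq># m"
          using P by (simp add: add_mset_subseteq_iff_in_diff)
        define k where "k = count (m - P) i"
        have k: "k \<noteq> 0" using in_m by (metis count_eq_zero_iff k_def)
        have "m - add_mset i P = m - P - {#i#}" by simp
        then have "m - P = add_mset i (m - add_mset i P)"
          using in_m by (simp only: insert_DiffM)
        then have "mfact (m - P) = k * mfact (m - add_mset i P)"
          unfolding k_def by (simp only: mfact_add_mset count_add_mset if_True simp_thms)
        then have "of_nat k * mbinom m P * of_nat (mfact P) = mbinom m (add_mset i P) * of_nat (mfact (add_mset i P))"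
          using k by (simp add: mbinom_def divide_simps del: mfact_add_mset)
        then show ?thesis
          unfolding step k_def[symmetric] using True sub by (simp add: P_def[symmetric] i_def[symmetric] mult_ac del: mfact_add_mset)
      next
        case False
        then have "\<not> add_mset i P \<subseteq># m"
          using P by (simp add: add_mset_subseteq_iff_in_diff)
        then show ?thesis
          unfolding step using True False by (simp add: P_def[symmetric] i_def[symmetric] not_in_iff)
      qed
    next
      case False
      then have "\<not> add_mset i P \<subseteq># m"
        by (meson subset_mset.order_trans mset_subset_eq_add_right multi_psub_of_add_self subset_mset.less_imp_le)
      then show ?thesis
        using True False IH by (simp add: J_product_def P_def[symmetric] i_def[symmetric])
    qed
  qed (use Cons in \<open>simp add: J_product_def\<close>)
qed (simp add: J_product_def mbinom_def)

lemma normal_ordered_J_fmon: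
  assumes "0 \<notin># m"
  shows "normal_ordered_J js (fmon m c) =
    (if pos_part js \<subseteq># m
     then fmon (m - pos_part js + neg_part js) (c * mbinom m (pos_part js) * of_nat (mfact (pos_part js)) * of_nat (prod_mset (pos_part js)))
     else 0)"
proof -
  have "normal_ordered_J js v = J_product (filter (\<lambda>j. j < 0) js) (J_product (filter (\<lambda>j. 0 < j) js) v)" for v
    by (simp add: normal_ordered_J_def J_product_def)
  moreover have "J_product xs 0 = 0" for xs
    by (induction xs) (simp_all add: J_product_def)
  ultimately show ?thesis
    using J_product_neg_fmon J_product_pos_fmon[OF assms] by simp
qed

section \<open>The coefficients of E_n on monomials\<close>

definition E_summand :: "int \<Rightarrow> int \<Rightarrow> fock \<Rightarrow> int list \<Rightarrow> fock" where
  "E_summand n r v js = (if 0 \<notin> set js \<and> sum_list js = n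
     then fock_const (fls_nth (E_coefficient js) r / fact (length js)) * normal_ordered_J js v else 0)"

lemma E_op_eq: "E_op n r v = Sum_any (E_summand n r v)"
  unfolding E_op_def E_summand_def ..

lemma E_summand_sum: "E_summand n r (\<Sum>i\<in>I. v i) js = (\<Sum>i\<in>I. E_summand n r (v i) js)"
  by (simp add: E_summand_def normal_ordered_J_def J_product_sum sum_distrib_left)

text \<open>\<open>Sum_any\<close> is 0 on an infinite support, so additivity needs one finite set
  of tuples that contains the supports of all summands.\<close>

lemma E_op_sum:
  assumes "finite I" "\<And>i. i \<in> I \<Longrightarrow> finite {js. E_summand n r (v i) js \<noteq> 0}"
  shows "E_op n r (\<Sum>i\<in>I. v i) = (\<Sum>i\<in>I. E_op n r (v i))"
proof -
  let ?Z = "\<Union>i\<in>I. {js. E_summand n r (v i) js \<noteq> 0}"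
  have Z: "finite ?Z" using assms by blast
  have "E_op n r (\<Sum>i\<in>I. v i) = (\<Sum>js\<in>?Z. E_summand n r (\<Sum>i\<in>I. v i) js)"
    unfolding E_op_eq by (intro Sum_any.expand_superset Z) (auto simp: E_summand_sum intro: ccontr dest: sum.not_neutral_contains_not_neutral)
  also have "\<dots> = (\<Sum>i\<in>I. \<Sum>js\<in>?Z. E_summand n r (v i) js)"
    by (simp add: E_summand_sum sum.swap[of _ I])
  also have "\<dots> = (\<Sum>i\<in>I. E_op n r (v i))"
    unfolding E_op_eq by (intro sum.cong refl Sum_any.expand_superset[symmetric] Z) auto
  finally show ?thesis .
qed

lemma finite_multisets_of_sum: "finite {Q :: nat multiset. 0 \<notin># Q \<and> sum_mset Q = k}"
proof (rule finite_subset)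
  have "size Q \<le> sum_mset Q" if "0 \<notin># Q" for Q :: "nat multiset"
    using that by (induction Q) auto
  moreover have "x \<le> sum_mset Q" if "x \<in># Q" for x and Q :: "nat multiset"
    using that by (metis insert_DiffM le_add1 sum_mset.add_mset)
  ultimately show "{Q :: nat multiset. 0 \<notin># Q \<and> sum_mset Q = k} \<subseteq> (\<Union>n\<le>k. multisets_of_size {..k} n)"
    by (auto simp: multisets_of_size_def)
qed auto

lemma finite_multisets_of_diff: "finite {Q :: nat multiset. 0 \<notin># Q \<and> int (sum_mset Q) = k}"
proof (rule finite_subset)
  show "{Q :: nat multiset. 0 \<notin># Q \<and> int (sum_mset Q) = k} \<subseteq> {Q. 0 \<notin># Q \<and> sum_mset Q = nat k}"
    by (metis (mono_tags, lifting) Collect_mono nat_int)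
qed (rule finite_multisets_of_sum)

text \<open>Tuples are grouped by their positive and negative parts. The group of (P, Q) consists of
  the N! / (P! Q!) orderings of \<open>signed_parts P Q\<close>: the N! cancels the 1 / N! of the
  definition, the P! cancels the one from \<open>J_product_pos_fmon\<close>, and 1 / Q! remains. The
  grouping also bounds the support, since P ranges over sub-multisets of m and n then fixes the
  total of Q.\<close>

lemma E_op_fmon_aux:
  fixes n :: int
  assumes "0 \<notin># m"
  defines "T \<equiv> (SIGMA P:{P. P \<subseteq># m}. {Q. 0 \<notin># Q \<and> int (sum_mset P) - int (sum_mset Q) = n})"
  shows "finite {js. E_summand n (int r) (fmon m c) js \<noteq> 0}"
    and "E_op n (int r) (fmon m c) = (\<Sum>(P, Q)\<in>T. fmon (m - P + Q)
      ((if size P + size Q \<le> r + 1 then vertex_series P Q $ (r + 1 - (size P + size Q)) else 0) *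
        c * mbinom m P * of_nat (prod_mset P) / of_nat (mfact Q)))"
    and "finite T"
proof -
  let ?co = "\<lambda>P Q. if size P + size Q \<le> r + 1 then vertex_series P Q $ (r + 1 - (size P + size Q)) else 0"
  have "finite {Q. 0 \<notin># Q \<and> int (sum_mset P) - int (sum_mset Q) = n}" for P :: "nat multiset"
    by (rule finite_subset[OF _ finite_multisets_of_diff[of "int (sum_mset P) - n"]]) auto
  then show T: "finite T" unfolding T_def by (intro finite_SigmaI) auto
  define Z where "Z = {js. 0 \<notin> set js \<and> sum_list js = n \<and> pos_part js \<subseteq># m}"
  have fibre: "{js \<in> Z. (pos_part js, neg_part js) = (P, Q)} = permutations_of_multiset (signed_parts P Q)"
    if "(P, Q) \<in> T" for P Q
  proof -
    have PQ: "P \<subseteq># m" "0 \<notin># P" "0 \<notin># Q" "int (sum_mset P) - int (sum_mset Q) = n"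
      using that assms(1) by (auto simp: T_def dest: mset_subset_eqD)
    show ?thesis
    proof (intro equalityI subsetI)
      fix js assume "js \<in> {js \<in> Z. (pos_part js, neg_part js) = (P, Q)}"
      then have "0 \<notin> set js" "pos_part js = P" "neg_part js = Q" by (auto simp: Z_def)
      then show "js \<in> permutations_of_multiset (signed_parts P Q)"
        using signed_parts_parts[of js] by (simp add: permutations_of_multiset_def)
    next
      fix js assume "js \<in> permutations_of_multiset (signed_parts P Q)"
      then have js: "mset js = signed_parts P Q" by (simp add: permutations_of_multiset_def)
      note p = parts_signed_parts[OF js PQ(2,3)]
      have "sum_list js = n" using sum_parts[of js] p PQ(4) by simp
      then show "js \<in> {js \<in> Z. (pos_part js, neg_part js) = (P, Q)}"
        using p PQ(1) by (simp add: Z_def)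
    qed
  qed
  have Z_T: "(\<lambda>js. (pos_part js, neg_part js)) ` Z \<subseteq> T"
    using sum_parts by (auto simp: Z_def T_def simp del: of_nat_sum_mset)
  have "Z \<subseteq> (\<Union>(P, Q)\<in>T. permutations_of_multiset (signed_parts P Q))"
  proof
    fix js assume "js \<in> Z"
    then have "(pos_part js, neg_part js) \<in> T" "js \<in> permutations_of_multiset (signed_parts (pos_part js) (neg_part js))"
      using Z_T by (auto simp: Z_def permutations_of_multiset_def signed_parts_parts)
    then show "js \<in> (\<Union>(P, Q)\<in>T. permutations_of_multiset (signed_parts P Q))" by blast
  qed
  then have Z: "finite Z" by (rule finite_subset) (use T in auto)
  have supp: "{js. E_summand n (int r) (fmon m c) js \<noteq> 0} \<subseteq> Z"
    by (auto simp: E_summand_def normal_ordered_J_fmon[OF assms(1)] Z_def split: if_splits)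
  then show "finite {js. E_summand n (int r) (fmon m c) js \<noteq> 0}"
    using Z finite_subset by blast
  have "E_op n (int r) (fmon m c) = (\<Sum>js\<in>Z. E_summand n (int r) (fmon m c) js)"
    unfolding E_op_eq by (rule Sum_any.expand_superset[OF Z supp])
  also have "\<dots> = (\<Sum>x\<in>T. \<Sum>js | js \<in> Z \<and> (pos_part js, neg_part js) = x. E_summand n (int r) (fmon m c) js)"
    by (rule sum.group[symmetric, OF Z T Z_T])
  also have "\<dots> = (\<Sum>(P, Q)\<in>T. fmon (m - P + Q) (?co P Q * c * mbinom m P * of_nat (prod_mset P) / of_nat (mfact Q)))"
  proof (rule sum.cong[OF refl], clarify)
    fix P Q assume PQ: "(P, Q) \<in> T"
    have P: "0 \<notin># P" using PQ assms(1) by (auto simp: T_def dest: mset_subset_eqD)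
    let ?A = "permutations_of_multiset (signed_parts P Q)"
    let ?N = "size P + size Q"
    define d where "d = ?co P Q / fact ?N * (c * mbinom m P * of_nat (mfact P) * of_nat (prod_mset P))"
    have "E_summand n (int r) (fmon m c) js = fmon (m - P + Q) d" if "js \<in> ?A" for js
    proof -
      have js: "0 \<notin> set js" "sum_list js = n" "P \<subseteq># m" "pos_part js = P" "neg_part js = Q"
        using that fibre[OF PQ] unfolding Z_def by auto
      have "length js = ?N" using size_parts[OF js(1)] js by simp
      then show ?thesis using js E_coefficient_nth[OF js(1), of r]
        by (simp add: E_summand_def normal_ordered_J_fmon[OF assms(1)] d_def)
    qed
    then have "(\<Sum>js\<in>?A. E_summand n (int r) (fmon m c) js) = fmon (m - P + Q) (of_nat (card ?A) * d)"
      by (simp add: fmon_def of_nat_mult_fock_single)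
    moreover have "of_nat (card ?A) * d = ?co P Q * c * mbinom m P * of_nat (prod_mset P) / of_nat (mfact Q)"
    proof -
      have "card ?A * (mfact P * mfact Q) = fact ?N"
        using card_permutations_of_multiset_aux[of "signed_parts P Q"] mfact_signed_parts[OF P, of Q]
        by (simp add: mfact_def) (simp add: signed_parts_def)
      then have "of_nat (card ?A) * (of_nat (mfact P) * of_nat (mfact Q)) = (fact ?N :: complex)"
        by (metis of_nat_fact of_nat_mult)
      then have "(of_nat (card ?A) :: complex) = fact ?N / (of_nat (mfact P) * of_nat (mfact Q))"
        by (simp add: field_simps)
      then show ?thesis unfolding d_def by (simp add: field_simps)
    qed
    ultimately show "(\<Sum>js | js \<in> Z \<and> (pos_part js, neg_part js) = (P, Q). E_summand n (int r) (fmon m c) js) =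
      fmon (m - P + Q) (?co P Q * c * mbinom m P * of_nat (prod_mset P) / of_nat (mfact Q))"
      using fibre[OF PQ] by simp
  qed
  finally show "E_op n (int r) (fmon m c) = \<dots>" .
qed

section \<open>Leaves and inner vertices as node operators\<close>

datatype node = Source nat | Vertex int nat | Sink nat

text \<open>P holds the outgoing and Q the incoming weights. \<open>F_op k r\<close> uses the index
  -k, so the total of P is that of Q minus k, which is leakiness k. The equation for h is r - 1 = 2
  h - 2 + valence written without subtraction, h being the genus of the vertex. A left leaf is an
  annihilator with one outgoing edge, a right leaf a creator with one incoming edge.\<close>

primrec node_rel :: "node \<Rightarrow> nat multiset \<Rightarrow> nat multiset \<Rightarrow> bool" where
  "node_rel (Source m) P Q \<longleftrightarrow> P = {#m#} \<and> Q = {#}"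
| "node_rel (Vertex k r) P Q \<longleftrightarrow> int (sum_mset P) - int (sum_mset Q) = - k \<and> (\<exists>h. r + 1 = 2 * h + (size P + size Q))"
| "node_rel (Sink n) P Q \<longleftrightarrow> P = {#} \<and> Q = {#n#}"

primrec node_coef :: "node \<Rightarrow> nat multiset \<Rightarrow> nat multiset \<Rightarrow> complex" where
  "node_coef (Source m) P Q = 1"
| "node_coef (Vertex k r) P Q = fact (r - 1) * vertex_factor ((r + 1 - (size P + size Q)) div 2) P Q"
| "node_coef (Sink n) P Q = 1"

primrec node_op :: "node \<Rightarrow> fock \<Rightarrow> fock" where
  "node_op (Source m) v = J (int m) v"
| "node_op (Vertex k r) v = fock_const (1 / of_nat r) * F_op k r v"
| "node_op (Sink n) v = J (- int n) v"

primrec node_ok :: "node \<Rightarrow> bool" where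
  "node_ok (Source m) \<longleftrightarrow> 0 < m"
| "node_ok (Vertex k r) \<longleftrightarrow> 0 < r"
| "node_ok (Sink n) \<longleftrightarrow> 0 < n"

lemma node_rel_finite: "finite {Q. 0 \<notin># Q \<and> node_rel nd P Q}"
proof (cases nd)
  case (Vertex k r)
  have "{Q. 0 \<notin># Q \<and> node_rel nd P Q} \<subseteq> {Q. 0 \<notin># Q \<and> int (sum_mset Q) = int (sum_mset P) + k}"
    by (auto simp: Vertex simp del: of_nat_sum_mset)
  then show ?thesis by (rule finite_subset) (rule finite_multisets_of_diff)
qed auto

lemma node_op_sum:
  assumes "finite I" "\<forall>i\<in>I. 0 \<notin># m i"
  shows "node_op nd (\<Sum>i\<in>I. fmon (m i) (x i)) = (\<Sum>i\<in>I. node_op nd (fmon (m i) (x i)))"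
proof (cases nd)
  case (Vertex k r)
  have "E_op (- k) (int r) (\<Sum>i\<in>I. fmon (m i) (x i)) = (\<Sum>i\<in>I. E_op (- k) (int r) (fmon (m i) (x i)))"
    using assms by (intro E_op_sum E_op_fmon_aux) auto
  then show ?thesis by (simp add: Vertex F_op_def sum_distrib_left)
qed (simp_all add: J_sum)

lemma node_op_fmon:
  assumes "node_ok nd" "0 \<notin># m"
  shows "node_op nd (fmon m c) = (\<Sum>P | P \<subseteq># m. \<Sum>Q | 0 \<notin># Q \<and> node_rel nd P Q.
    fmon (m - P + Q) (c * mbinom m P * of_nat (prod_mset P) * node_coef nd P Q / of_nat (mfact Q)))"
proof (cases nd)
  case (Source j)
  have Q: "{Q. 0 \<notin># Q \<and> node_rel nd P Q} = (if P = {#j#} then {{#}} else {})" for P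
    by (auto simp: Source)
  show ?thesis
  proof (cases "j \<in># m")
    case True
    have "mbinom m {#j#} = of_nat (count m j)"
      using mfact_add_mset[of j "m - {#j#}"] True by (simp add: mbinom_def)
    moreover have "(\<Sum>P | P \<subseteq># m. \<Sum>Q | 0 \<notin># Q \<and> node_rel nd P Q.
        fmon (m - P + Q) (c * mbinom m P * of_nat (prod_mset P) * node_coef nd P Q / of_nat (mfact Q))) =
      (\<Sum>P\<in>{{#j#}}. fmon (m - P) (c * mbinom m P * of_nat (prod_mset P)))"
      unfolding Q using True by (intro sum.mono_neutral_cong_right) (auto simp: Source)
    ultimately show ?thesis
      using assms by (simp add: Source J_pos_fmon mult_ac)
  next
    case False
    then have "(\<Sum>P | P \<subseteq># m. \<Sum>Q | 0 \<notin># Q \<and> node_rel nd P Q.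
        fmon (m - P + Q) (c * mbinom m P * of_nat (prod_mset P) * node_coef nd P Q / of_nat (mfact Q))) = 0"
      unfolding Q by (intro sum.neutral) auto
    with False assms show ?thesis by (simp add: Source J_pos_fmon not_in_iff[THEN iffD1])
  qed
next
  case (Sink j)
  have Q: "{Q. 0 \<notin># Q \<and> node_rel nd P Q} = (if P = {#} then {{#j#}} else {})" for P
    using assms(1) by (auto simp: Sink)
  have "(\<Sum>P | P \<subseteq># m. \<Sum>Q | 0 \<notin># Q \<and> node_rel nd P Q.
      fmon (m - P + Q) (c * mbinom m P * of_nat (prod_mset P) * node_coef nd P Q / of_nat (mfact Q))) =
    (\<Sum>P\<in>{{#} :: nat multiset}. fmon (m + {#j#}) c)"
    unfolding Q by (intro sum.mono_neutral_cong_right) (auto simp: Sink mbinom_def)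
  then show ?thesis using assms by (simp add: Sink J_neg_fmon)
next
  case (Vertex k r)
  define T where "T = (SIGMA P:{P. P \<subseteq># m}. {Q. 0 \<notin># Q \<and> int (sum_mset P) - int (sum_mset Q) = - k})"
  define T' where "T' = (SIGMA P:{P. P \<subseteq># m}. {Q. 0 \<notin># Q \<and> node_rel nd P Q})"
  \<comment> \<open>\<open>co\<close> is the coefficient that \<open>E_op_fmon_aux\<close> produces;
    it must be compared with \<open>node_coef\<close>, which is expressed through a genus and
    therefore meaningful only on \<open>T'\<close>.\<close>
  define co where "co P Q = (if size P + size Q \<le> r + 1 then vertex_series P Q $ (r + 1 - (size P + size Q)) else 0)" for P Q
  have r: "(fact r :: complex) / of_nat r = fact (r - 1)"
    using assms(1) by (cases r) (simp_all add: Vertex del: of_nat_Suc)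
  have "E_op (- k) (int r) (fmon m c) = (\<Sum>(P, Q)\<in>T. fmon (m - P + Q)
      (co P Q * c * mbinom m P * of_nat (prod_mset P) / of_nat (mfact Q)))"
    unfolding T_def co_def by (rule E_op_fmon_aux(2)[OF assms(2)])
  then have "node_op nd (fmon m c) = (\<Sum>(P, Q)\<in>T. fmon (m - P + Q)
      ((fact r / of_nat r) * (co P Q * c * mbinom m P * of_nat (prod_mset P) / of_nat (mfact Q))))"
    by (simp add: Vertex F_op_def sum_distrib_left case_prod_unfold)
  also have "\<dots> = (\<Sum>(P, Q)\<in>T'. fmon (m - P + Q) (c * mbinom m P * of_nat (prod_mset P) * node_coef nd P Q / of_nat (mfact Q)))"
  proof (rule sum.mono_neutral_cong_right)
    show "finite T" unfolding T_def by (rule E_op_fmon_aux(3)[OF assms(2)])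
    show "T' \<subseteq> T" by (auto simp: T_def T'_def Vertex simp del: of_nat_sum_mset)
    \<comment> \<open>The expansion of E also contains pairs (P, Q) that admit no genus h. For them
      r + 1 - (size P + size Q) is negative or odd, and the coefficient vanishes.\<close>
    have "co P Q = 0" if "(P, Q) \<in> T - T'" for P Q
    proof (rule ccontr)
      assume "co P Q \<noteq> 0"
      then have le: "size P + size Q \<le> r + 1" and nz: "vertex_series P Q $ (r + 1 - (size P + size Q)) \<noteq> 0"
        by (simp_all add: co_def split: if_splits)
      from nz have "even (r + 1 - (size P + size Q))"
        using vertex_series_nth_odd by blast
      then obtain h where "r + 1 - (size P + size Q) = 2 * h" by blast
      with le have "r + 1 = 2 * h + (size P + size Q)" by linarith
      then have "node_rel nd P Q" using that by (auto simp: T_def Vertex simp del: of_nat_sum_mset)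
      then show False using that by (auto simp: T_def T'_def)
    qed
    then show "\<forall>i\<in>T - T'. (case i of (P, Q) \<Rightarrow> fmon (m - P + Q)
      ((fact r / of_nat r) * (co P Q * c * mbinom m P * of_nat (prod_mset P) / of_nat (mfact Q)))) = 0"
      by auto
    have co: "fact (r - 1) * co P Q = node_coef nd P Q" if "(P, Q) \<in> T'" for P Q
      using that by (auto simp: T'_def Vertex co_def vertex_factor_def vertex_series_def)
    show "(case x of (P, Q) \<Rightarrow> fmon (m - P + Q)
      ((fact r / of_nat r) * (co P Q * c * mbinom m P * of_nat (prod_mset P) / of_nat (mfact Q)))) =
      (case x of (P, Q) \<Rightarrow> fmon (m - P + Q) (c * mbinom m P * of_nat (prod_mset P) * node_coef nd P Q / of_nat (mfact Q)))"
      if "x \<in> T'" for x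
    proof -
      obtain P Q where x: "x = (P, Q)" by fastforce
      show ?thesis
        using co[of P Q] that unfolding r x by (simp add: mult_ac)
    qed
  qed
  also have "\<dots> = (\<Sum>P | P \<subseteq># m. \<Sum>Q | 0 \<notin># Q \<and> node_rel nd P Q.
    fmon (m - P + Q) (c * mbinom m P * of_nat (prod_mset P) * node_coef nd P Q / of_nat (mfact Q)))"
    unfolding T'_def by (rule sum.Sigma[symmetric]) (use node_rel_finite in auto)
  finally show ?thesis .
qed

definition admissible :: "node list \<Rightarrow> (nat \<times> nat \<times> nat) multiset set" where
  "admissible ns = {N. (\<forall>(a, b, w)\<in>#N. a < b \<and> b < length ns \<and> 0 < w) \<and>
     (\<forall>a<length ns. node_rel (ns ! a) (out_at N a) (in_at N a))}"

definition node_list :: "nat list \<Rightarrow> nat list \<Rightarrow> int list \<Rightarrow> nat list \<Rightarrow> node list" where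
  "node_list \<mu> \<nu> ks rs = map Source \<mu> @ map (\<lambda>(k, r). Vertex k r) (zip ks rs) @ map Sink \<nu>"

lemma node_operators_nodes:
  assumes "\<forall>nd\<in>set ns. node_ok nd"
  shows "node_operators (length ns) (\<lambda>a. node_rel (ns ! a)) (\<lambda>a. node_coef (ns ! a)) (\<lambda>a. node_op (ns ! a))"
  using assms by unfold_locales (simp_all add: node_rel_finite node_op_sum node_op_fmon)

lemma foldr_node_op:
  "J_product (map int \<mu>) \<circ> foldr (\<lambda>(k, r) v. fock_const (1 / of_nat r) * F_op k r v) (zip ks rs)
     \<circ> J_product (map (\<lambda>n. - int n) \<nu>) =
   foldr (\<lambda>a. node_op (node_list \<mu> \<nu> ks rs ! a)) [0..<length (node_list \<mu> \<nu> ks rs)]"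
proof -
  have "foldr (\<lambda>a. node_op (ns ! a)) [0..<length ns] = foldr node_op (map ((!) ns) [0..<length ns])" for ns
    by (rule ext) (simp only: foldr_map o_def)
  then have 1: "foldr (\<lambda>a. node_op (ns ! a)) [0..<length ns] = foldr node_op ns" for ns
    by (simp only: map_nth)
  have 2: "node_op \<circ> Source = J \<circ> int" "node_op \<circ> Sink = J \<circ> (\<lambda>n. - int n)"
    "node_op \<circ> (\<lambda>(k, r). Vertex k r) = (\<lambda>(k, r) v. fock_const (1 / of_nat r) * F_op k r v)"
    by (auto simp: fun_eq_iff)
  show ?thesis
    unfolding 1 node_list_def J_product_def by (rule ext) (simp add: foldr_map 2)
qed

theorem leaky_hurwitz_eq_sum:
  fixes \<mu> \<nu> rs :: "nat list" and ks :: "int list"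
  defines "ns \<equiv> node_list \<mu> \<nu> ks rs"
  assumes "\<forall>nd\<in>set ns. node_ok nd"
  shows "leaky_hurwitz g \<mu> \<nu> ks rs = (\<Sum>N\<in>admissible ns.
    (\<Prod>a<length ns. node_coef (ns ! a) (out_at N a) (in_at N a)) *
    ((\<Prod>(a, b, w)\<in>#N. of_nat w) / (of_nat (prod_list \<mu>) * of_nat (prod_list \<nu>))) / of_nat (mfact N))"
proof -
  interpret node_operators "length ns" "\<lambda>a. node_rel (ns ! a)" "\<lambda>a. node_coef (ns ! a)" "\<lambda>a. node_op (ns ! a)"
    using assms(2) by (rule node_operators_nodes)
  have "closed_configs = admissible ns"
    by (simp add: closed_configs_def admissible_def)
  then show ?thesis
    unfolding leaky_hurwitz_def foldr_node_op vacuum_expectation_foldr_Op[unfolded ns_def]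
    by (simp add: ns_def sum_distrib_left)
qed

section \<open>Counting isomorphisms of covers\<close>

lemma pair_mset_eq_iff: "{#a, b#} = {#c, d#} \<longleftrightarrow> a = c \<and> b = d \<or> a = d \<and> b = c"
  by (auto simp: add_eq_conv_ex)

text \<open>Restricting to extensional functions makes the set finite for finite A and B, and agrees
  with the convention in \<open>cover_isos\<close>.\<close>

definition matchings :: "('a \<Rightarrow> 'k) \<Rightarrow> 'a set \<Rightarrow> ('b \<Rightarrow> 'k) \<Rightarrow> 'b set \<Rightarrow> ('a \<Rightarrow> 'b) set" where
  "matchings f A g B = {\<psi> \<in> extensional A. bij_betw \<psi> A B \<and> (\<forall>x\<in>A. g (\<psi> x) = f x)}"

lemma matchings_insert:
  assumes "x \<notin> A"
  shows "matchings f (insert x A) g B =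
    (\<Union>y\<in>{y\<in>B. g y = f x}. (\<lambda>\<psi>. \<psi>(x := y)) ` matchings f A g (B - {y}))"
proof (intro equalityI subsetI)
  fix \<psi> assume \<psi>: "\<psi> \<in> matchings f (insert x A) g B"
  \<comment> \<open>Resetting the value at x makes the restriction extensional on A.\<close>
  define \<psi>' where "\<psi>' = \<psi>(x := undefined)"
  have bij: "bij_betw \<psi> (insert x A) B" using \<psi> by (simp add: matchings_def)
  have "bij_betw \<psi> A (B - {\<psi> x})"
  proof -
    have "bij_betw \<psi> (insert x A - {x}) (B - {\<psi> x})"
      using bij by (intro bij_betw_DiffI) (auto simp: bij_betw_def)
    then show ?thesis using assms by simp
  qed
  moreover have "bij_betw \<psi>' A (B - {\<psi> x}) \<longleftrightarrow> bij_betw \<psi> A (B - {\<psi> x})"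
    using assms by (intro bij_betw_cong) (auto simp: \<psi>'_def)
  ultimately have "\<psi>' \<in> matchings f A g (B - {\<psi> x})"
    using \<psi> assms by (auto simp: matchings_def \<psi>'_def extensional_def)
  moreover have "\<psi> = \<psi>'(x := \<psi> x)" by (simp add: \<psi>'_def)
  moreover have "\<psi> x \<in> {y\<in>B. g y = f x}"
    using \<psi> bij by (auto simp: matchings_def bij_betw_def)
  ultimately show "\<psi> \<in> (\<Union>y\<in>{y\<in>B. g y = f x}. (\<lambda>\<psi>. \<psi>(x := y)) ` matchings f A g (B - {y}))"
    by blast
next
  fix \<psi> assume "\<psi> \<in> (\<Union>y\<in>{y\<in>B. g y = f x}. (\<lambda>\<psi>. \<psi>(x := y)) ` matchings f A g (B - {y}))"
  then obtain y \<psi>' where y: "y \<in> B" "g y = f x" and \<psi>': "\<psi>' \<in> matchings f A g (B - {y})" and eq: "\<psi> = \<psi>'(x := y)"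
    by blast
  have "bij_betw \<psi> A (B - {y}) \<longleftrightarrow> bij_betw \<psi>' A (B - {y})"
    using assms by (intro bij_betw_cong) (auto simp: eq)
  then have "bij_betw \<psi> (insert x A) B"
    using \<psi>' y assms notIn_Un_bij_betw[of x A \<psi> "B - {y}"] by (simp add: matchings_def eq insert_absorb)
  then show "\<psi> \<in> matchings f (insert x A) g B"
    using \<psi>' y assms by (auto simp: matchings_def eq extensional_def)
qed

lemma finite_matchings: "finite A \<Longrightarrow> finite B \<Longrightarrow> finite (matchings f A g B)"
  by (rule finite_subset[OF _ finite_PiE[of A "\<lambda>_. B"]])
    (auto simp: matchings_def PiE_def bij_betw_def)

text \<open>A new element x can go to as many elements of B as carry the label \<open>f x\<close>,
  which is the factor by which \<open>mfact\<close> grows in \<open>mfact_add_mset\<close>; the rest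
  is a matching onto B without the chosen element.\<close>

lemma card_matchings:
  assumes "finite A" "finite B" "image_mset f (mset_set A) = image_mset g (mset_set B)"
  shows "card (matchings f A g B) = mfact (image_mset f (mset_set A))"
  using assms
proof (induction A arbitrary: B rule: finite_induct)
  case empty
  then have "B = {}"
    by (metis finite.emptyI image_mset_is_empty_iff mset_set.empty mset_set_empty_iff)
  then have "matchings f {} g B = {\<lambda>x. undefined}"
    by (auto simp: matchings_def bij_betw_def)
  then show ?case by simp
next
  case (insert x A)
  let ?N = "image_mset f (mset_set A)"
  have eq: "add_mset (f x) ?N = image_mset g (mset_set B)"
    using insert by simp
  have rec: "card (matchings f A g (B - {y})) = mfact ?N" if y: "y \<in> B" "g y = f x" for y
  proof (rule insert.IH)
    have "mset_set B = add_mset y (mset_set (B - {y}))"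
      using y insert.prems by (simp add: mset_set.remove)
    then show "?N = image_mset g (mset_set (B - {y}))"
      using eq y by simp
  qed (use insert in auto)
  have inj: "inj_on (\<lambda>\<psi>. \<psi>(x := y)) (matchings f A g B')" for y B'
  proof (rule inj_onI)
    fix \<psi> \<phi> assume "\<psi> \<in> matchings f A g B'" "\<phi> \<in> matchings f A g B'" and e: "\<psi>(x := y) = \<phi>(x := y)"
    then have "\<psi> x = undefined" "\<phi> x = undefined"
      using insert.hyps by (auto simp: matchings_def extensional_def)
    then show "\<psi> = \<phi>" using e by (metis fun_upd_triv fun_upd_upd)
  qed
  have "card (matchings f (insert x A) g B) = (\<Sum>y\<in>{y\<in>B. g y = f x}. card ((\<lambda>\<psi>. \<psi>(x := y)) ` matchings f A g (B - {y})))"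
    unfolding matchings_insert[OF insert.hyps(2)]
  proof (rule card_UN_disjoint)
    show "\<forall>i\<in>{y \<in> B. g y = f x}. \<forall>j\<in>{y \<in> B. g y = f x}. i \<noteq> j \<longrightarrow>
       (\<lambda>\<psi>. \<psi>(x := i)) ` matchings f A g (B - {i}) \<inter> (\<lambda>\<psi>. \<psi>(x := j)) ` matchings f A g (B - {j}) = {}"
      by (auto dest: fun_cong[of _ _ x])
  qed (use insert in \<open>auto intro!: finite_matchings\<close>)
  also have "\<dots> = (\<Sum>y\<in>{y\<in>B. g y = f x}. mfact ?N)"
    by (intro sum.cong refl) (simp add: card_image[OF inj] rec)
  also have "\<dots> = card {y\<in>B. g y = f x} * mfact ?N" by simp
  also have "card {y\<in>B. g y = f x} = count (image_mset g (mset_set B)) (f x)"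
    using insert.prems by (simp add: count_image_mset' flip: filter_mset_mset_set size_mset_set) (metis (mono_tags, lifting) Collect_cong)
  also have "\<dots> * mfact ?N = mfact (image_mset f (mset_set (insert x A)))"
    using insert.hyps by (simp add: eq[symmetric])
  finally show ?case .
qed

lemma sum_lessThan_add: "(\<Sum>a<m + n. f a) = (\<Sum>a<m. f a) + (\<Sum>i<n. f (m + i))" for n :: nat
  by (induction n) (simp_all add: add.assoc)

lemma sum_list_incidence:
  "(\<Sum>x\<leftarrow>xs. count {#fst x, fst (snd x)#} v) = size (out_at (mset xs) v) + size (in_at (mset xs) v)"
  by (induction xs) (auto simp: out_at_def in_at_def)

lemma ereal_divide_mult_cancel:
  fixes x :: ereal
  assumes "0 < w"
  shows "x = ereal w * (x / ereal w)"
  using assms by (cases x) auto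

lemma prod_lessThan_add: "(\<Prod>a<m + n. f a) = (\<Prod>a<m. f a) * (\<Prod>i<n. f (m + i))" for n :: nat
  by (induction n) (simp_all add: mult.assoc)

text \<open>The classes are the fibres of c on S, so any representative chosen by
  \<open>SOME\<close> has the right value of c.\<close>

lemma sum_classes:
  assumes "\<And>x y. x \<in> S \<Longrightarrow> y \<in> S \<Longrightarrow> (x, y) \<in> r \<longleftrightarrow> c x = c y"
  shows "(\<Sum>X\<in>S // Restr r S. f (c (SOME x. x \<in> X))) = (\<Sum>n\<in>c ` S. f n)"
proof -
  have class_eq: "Restr r S `` {x} = {y \<in> S. c y = c x}" if "x \<in> S" for x
    using assms[OF that] that by auto
  define K where "K n = {y \<in> S. c y = n}" for n
  have K: "c (SOME y. y \<in> K n) = n" if "n \<in> c ` S" for n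
  proof -
    have "\<exists>y. y \<in> K n" using that by (auto simp: K_def)
    then have "(SOME y. y \<in> K n) \<in> K n" by (rule someI_ex)
    then show ?thesis by (simp add: K_def)
  qed
  have "S // Restr r S = K ` c ` S"
    using class_eq by (auto simp: quotient_def K_def)
  moreover have "inj_on K (c ` S)"
    by (rule inj_on_inverseI[of _ "\<lambda>X. c (SOME y. y \<in> X)"]) (rule K)
  ultimately show ?thesis
    by (simp add: sum.reindex K)
qed

section \<open>Numbered vertices and edge codes of a cover\<close>

text \<open>The position in this list is the node number used in \<open>node_list\<close>, which
  lets edges of a cover be compared with triples of the Wick expansion.\<close>

definition vlist :: "real list \<Rightarrow> ('v, 'e) tropical_cover \<Rightarrow> 'v list" where
  "vlist ps \<pi> = left_leaves \<pi> @ map (\<lambda>x. vertex_over \<pi> x) ps @ right_leaves \<pi>"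

locale cover_problem =
  fixes \<mu> \<nu> rs :: "nat list" and ks :: "int list" and ps :: "real list" and g :: nat
  assumes \<mu>_pos: "\<forall>m\<in>set \<mu>. 0 < m" and \<nu>_pos: "\<forall>n\<in>set \<nu>. 0 < n" and rs_pos: "\<forall>r\<in>set rs. 0 < r"
    and len_ks: "length ks = length ps" and len_rs: "length rs = length ps"
    and sorted_ps: "sorted_wrt (<) ps"
    and Riemann_Hurwitz: "(\<Sum>i<length ps. int (rs ! i) - 1) = 2 * int g - 2 + int (length \<mu>) + int (length \<nu>)"
begin

abbreviation "nodes \<equiv> node_list \<mu> \<nu> ks rs"

definition M :: nat where "M = length \<mu> + length ps + length \<nu>"

definition pts :: "ereal list" where
  "pts = replicate (length \<mu>) (-\<infinity>) @ map ereal ps @ replicate (length \<nu>) \<infinity>"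

lemma length_nodes: "length nodes = M"
  by (simp add: node_list_def M_def len_ks len_rs)

lemma nodes_nth:
  "a < length \<mu> \<Longrightarrow> nodes ! a = Source (\<mu> ! a)"
  "i < length ps \<Longrightarrow> nodes ! (length \<mu> + i) = Vertex (ks ! i) (rs ! i)"
  "j < length \<nu> \<Longrightarrow> nodes ! (length \<mu> + length ps + j) = Sink (\<nu> ! j)"
  by (simp_all add: node_list_def nth_append len_ks len_rs)

lemma nodes_ok: "\<forall>nd\<in>set nodes. node_ok nd"
  using \<mu>_pos \<nu>_pos rs_pos by (auto simp: node_list_def dest: set_zip_rightD)

lemma pts_nth:
  "a < length \<mu> \<Longrightarrow> pts ! a = -\<infinity>"
  "i < length ps \<Longrightarrow> pts ! (length \<mu> + i) = ereal (ps ! i)"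
  "j < length \<nu> \<Longrightarrow> pts ! (length \<mu> + length ps + j) = \<infinity>"
  by (simp_all add: pts_def nth_append)

lemma length_pts: "length pts = M"
  by (simp add: pts_def M_def)

lemma node_cases:
  assumes "a < M"
  obtains "a < length \<mu>" | i where "i < length ps" "a = length \<mu> + i"
    | j where "j < length \<nu>" "a = length \<mu> + length ps + j"
proof -
  consider "a < length \<mu>" | "length \<mu> \<le> a" "a < length \<mu> + length ps" | "length \<mu> + length ps \<le> a" by linarith
  then show thesis
  proof cases
    case 2
    then show thesis using that(2)[of "a - length \<mu>"] by simp
  next
    case 3
    then show thesis using that(3)[of "a - (length \<mu> + length ps)"] assms by (simp add: M_def)
  qed (rule that(1))
qed

lemma sorted_pts: "sorted pts"
  unfolding pts_def using strict_sorted_imp_sorted[OF sorted_ps]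
  by (auto simp: sorted_append sorted_wrt_map)

lemma pts_less_imp_less:
  assumes "a < M" "pts ! a < pts ! b"
  shows "a < b"
  using sorted_nth_mono[OF sorted_pts, of b a] assms by (force simp: length_pts)

text \<open>\<open>bd\<close> is unordered; the condition a < b picks the orientation and so makes
  the triple unique once the vertex list is distinct.\<close>

definition is_key :: "('v, 'e) tropical_cover \<Rightarrow> 'e \<Rightarrow> nat \<times> nat \<times> nat \<Rightarrow> bool" where
  "is_key \<pi> e = (\<lambda>(a, b, w). a < b \<and> b < M \<and> bd \<pi> e = {#vlist ps \<pi> ! a, vlist ps \<pi> ! b#} \<and> weight \<pi> e = w)"

definition key :: "('v, 'e) tropical_cover \<Rightarrow> 'e \<Rightarrow> nat \<times> nat \<times> nat" where
  "key \<pi> e = (THE x. is_key \<pi> e x)"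

definition code :: "('v, 'e) tropical_cover \<Rightarrow> (nat \<times> nat \<times> nat) multiset" where
  "code \<pi> = image_mset (key \<pi>) (mset_set (edges \<pi>))"

text \<open>The part of the cover axioms on which codes depend. It is kept separate because codes
  are also computed for \<open>cover_of xs\<close> before that is known to be a cover.\<close>

definition layered :: "('v, 'e) tropical_cover \<Rightarrow> bool" where
  "layered \<pi> \<longleftrightarrow> finite (edges \<pi>) \<and> distinct (vlist ps \<pi>) \<and> length (vlist ps \<pi>) = M \<and>
     (\<forall>a<M. vmap \<pi> (vlist ps \<pi> ! a) = pts ! a) \<and>
     (\<forall>e\<in>edges \<pi>. 0 < weight \<pi> e \<and>
       (\<exists>a<M. \<exists>b<M. bd \<pi> e = {#vlist ps \<pi> ! a, vlist ps \<pi> ! b#} \<and> pts ! a < pts ! b))"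

lemma key_eqI:
  assumes "layered \<pi>" "is_key \<pi> e x"
  shows "key \<pi> e = x"
  unfolding key_def
proof (rule the_equality[where P = "is_key \<pi> e", OF assms(2)])
  fix y assume "is_key \<pi> e y"
  then show "y = x"
    using assms by (auto simp: is_key_def layered_def pair_mset_eq_iff nth_eq_iff_index_eq)
qed

lemma keyE:
  assumes "layered \<pi>" "e \<in> edges \<pi>"
  obtains a b where "key \<pi> e = (a, b, weight \<pi> e)" "a < b" "b < M" "pts ! a < pts ! b"
    "bd \<pi> e = {#vlist ps \<pi> ! a, vlist ps \<pi> ! b#}" "0 < weight \<pi> e"
proof -
  obtain a b where ab: "a < M" "b < M" "bd \<pi> e = {#vlist ps \<pi> ! a, vlist ps \<pi> ! b#}" "pts ! a < pts ! b" "0 < weight \<pi> e"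
    using assms by (auto simp: layered_def)
  then have "is_key \<pi> e (a, b, weight \<pi> e)"
    using pts_less_imp_less by (simp add: is_key_def)
  from key_eqI[OF assms(1) this] show thesis
    using ab pts_less_imp_less by (intro that[of a b]) auto
qed

lemma outgoing_vlist:
  assumes "layered \<pi>" "a < M"
  shows "outgoing \<pi> (vlist ps \<pi> ! a) = {e \<in> edges \<pi>. fst (key \<pi> e) = a}"
proof -
  have "(\<exists>u. bd \<pi> e = {#vlist ps \<pi> ! a, u#} \<and> vmap \<pi> (vlist ps \<pi> ! a) < vmap \<pi> u) \<longleftrightarrow> fst (key \<pi> e) = a"
    if "e \<in> edges \<pi>" for e
    using keyE[OF assms(1) that]
  proof cases
    case (1 c d)
    then show ?thesis
      using assms by (auto simp: layered_def pair_mset_eq_iff nth_eq_iff_index_eq)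
  qed
  then show ?thesis unfolding outgoing_def by blast
qed

lemma incoming_vlist:
  assumes "layered \<pi>" "b < M"
  shows "incoming \<pi> (vlist ps \<pi> ! b) = {e \<in> edges \<pi>. fst (snd (key \<pi> e)) = b}"
proof -
  have "(\<exists>u. bd \<pi> e = {#u, vlist ps \<pi> ! b#} \<and> vmap \<pi> u < vmap \<pi> (vlist ps \<pi> ! b)) \<longleftrightarrow> fst (snd (key \<pi> e)) = b"
    if "e \<in> edges \<pi>" for e
    using keyE[OF assms(1) that]
  proof cases
    case (1 c d)
    then show ?thesis
      using assms by (auto simp: layered_def pair_mset_eq_iff nth_eq_iff_index_eq)
  qed
  then show ?thesis unfolding incoming_def by blast
qed

lemma snd_snd_key: "layered \<pi> \<Longrightarrow> e \<in> edges \<pi> \<Longrightarrow> snd (snd (key \<pi> e)) = weight \<pi> e"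
  by (metis keyE snd_conv)

lemma out_weights_vlist:
  assumes "layered \<pi>" "a < M"
  shows "out_weights \<pi> (vlist ps \<pi> ! a) = out_at (code \<pi>) a"
  using assms by (auto simp: out_weights_def outgoing_vlist out_at_def code_def filter_mset_image_mset
      multiset.map_comp snd_snd_key layered_def intro!: image_mset_cong)

lemma in_weights_vlist:
  assumes "layered \<pi>" "a < M"
  shows "in_weights \<pi> (vlist ps \<pi> ! a) = in_at (code \<pi>) a"
  using assms by (auto simp: in_weights_def incoming_vlist in_at_def code_def filter_mset_image_mset
      multiset.map_comp snd_snd_key layered_def intro!: image_mset_cong)

lemma valence_vlist:
  assumes "layered \<pi>" "a < M"
  shows "valence \<pi> (vlist ps \<pi> ! a) = size (out_at (code \<pi>) a) + size (in_at (code \<pi>) a)"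
proof -
  have "count (bd \<pi> e) (vlist ps \<pi> ! a) = (if fst (key \<pi> e) = a then 1 else 0) + (if fst (snd (key \<pi> e)) = a then 1 else 0)"
    if "e \<in> edges \<pi>" for e
    using keyE[OF assms(1) that]
  proof cases
    case (1 c d)
    then show ?thesis using assms by (auto simp: layered_def nth_eq_iff_index_eq)
  qed
  then have "valence \<pi> (vlist ps \<pi> ! a) = card {e \<in> edges \<pi>. fst (key \<pi> e) = a} + card {e \<in> edges \<pi>. fst (snd (key \<pi> e)) = a}"
    using assms(1) by (simp add: valence_def sum.distrib layered_def flip: sum.inter_filter)
  moreover have "size (out_at (code \<pi>) a) = card {e \<in> edges \<pi>. fst (key \<pi> e) = a}"
    "size (in_at (code \<pi>) a) = card {e \<in> edges \<pi>. fst (snd (key \<pi> e)) = a}"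
    using assms(1) by (simp_all add: out_at_def in_at_def code_def filter_mset_image_mset layered_def)
  ultimately show ?thesis by simp
qed

section \<open>Codes of covers are admissible\<close>

abbreviation covers :: "(nat, nat) tropical_cover set" where
  "covers \<equiv> leaky_covers ps g \<mu> \<nu> ks rs"

lemma vlist_nth:
  assumes "length (left_leaves \<pi>) = length \<mu>"
  shows "a < length \<mu> \<Longrightarrow> vlist ps \<pi> ! a = left_leaves \<pi> ! a"
    "i < length ps \<Longrightarrow> vlist ps \<pi> ! (length \<mu> + i) = vertex_over \<pi> (ps ! i)"
    "vlist ps \<pi> ! (length \<mu> + length ps + j) = right_leaves \<pi> ! j"
  using assms by (simp_all add: vlist_def nth_append)

lemma covers_leaves:
  assumes "\<pi> \<in> covers"
  shows "distinct (left_leaves \<pi>)" "set (left_leaves \<pi>) = {v \<in> leaves \<pi>. vmap \<pi> v = -\<infinity>}"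
    "length (left_leaves \<pi>) = length \<mu>"
    "distinct (right_leaves \<pi>)" "set (right_leaves \<pi>) = {v \<in> leaves \<pi>. vmap \<pi> v = \<infinity>}"
    "length (right_leaves \<pi>) = length \<nu>"
    "leaves \<pi> = set (left_leaves \<pi>) \<union> set (right_leaves \<pi>)"
  using assms unfolding leaky_covers_def has_profile_def is_tropical_cover_def by auto

lemma vertex_over_eqI:
  assumes "\<pi> \<in> covers" "i < length ps" "v \<in> vertices \<pi>" "vmap \<pi> v = ereal (ps ! i)"
  shows "vertex_over \<pi> (ps ! i) = v"
proof -
  have "\<exists>!v. v \<in> vertices \<pi> \<and> vmap \<pi> v = ereal (ps ! i)"
    using assms(1,2) by (simp add: leaky_covers_def)
  then show ?thesis unfolding vertex_over_def using assms(3,4) by (auto intro: the1_equality)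
qed

lemma vertex_over_inner:
  assumes "\<pi> \<in> covers" "i < length ps"
  shows "vertex_over \<pi> (ps ! i) \<in> inner \<pi>" "vmap \<pi> (vertex_over \<pi> (ps ! i)) = ereal (ps ! i)"
proof -
  have "\<exists>!v. v \<in> vertices \<pi> \<and> vmap \<pi> v = ereal (ps ! i)"
    using assms by (simp add: leaky_covers_def)
  from theI'[OF this]
  have 1: "vertex_over \<pi> (ps ! i) \<in> vertices \<pi>" "vmap \<pi> (vertex_over \<pi> (ps ! i)) = ereal (ps ! i)"
    unfolding vertex_over_def by auto
  moreover have "v \<notin> leaves \<pi>" if "vmap \<pi> v = ereal x" for v x
    using assms(1) that by (auto simp: leaky_covers_def is_tropical_cover_def)
  ultimately show "vertex_over \<pi> (ps ! i) \<in> inner \<pi>" "vmap \<pi> (vertex_over \<pi> (ps ! i)) = ereal (ps ! i)"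
    by (auto simp: vertices_def)
qed

lemma covers_inner:
  assumes "\<pi> \<in> covers"
  shows "inner \<pi> = vertex_over \<pi> ` set ps"
proof (intro equalityI subsetI)
  fix v assume v: "v \<in> inner \<pi>"
  then obtain x where "x \<in> set ps" "vmap \<pi> v = ereal x"
    using assms by (auto simp: leaky_covers_def is_tropical_cover_def)
  then show "v \<in> vertex_over \<pi> ` set ps"
    using vertex_over_eqI[OF assms] v by (metis UnI2 image_eqI in_set_conv_nth vertices_def)
next
  fix v assume "v \<in> vertex_over \<pi> ` set ps"
  then show "v \<in> inner \<pi>"
    using vertex_over_inner[OF assms] by (auto simp: in_set_conv_nth)
qed

lemma set_vlist: "\<pi> \<in> covers \<Longrightarrow> set (vlist ps \<pi>) = vertices \<pi>"
  by (auto simp: vlist_def vertices_def covers_inner covers_leaves(7))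

lemma length_vlist: "\<pi> \<in> covers \<Longrightarrow> length (vlist ps \<pi>) = M"
  by (simp add: vlist_def M_def covers_leaves)

lemma vmap_vlist:
  assumes "\<pi> \<in> covers" "a < M"
  shows "vmap \<pi> (vlist ps \<pi> ! a) = pts ! a"
  using assms(2)
proof (cases rule: node_cases)
  case 1
  then have "left_leaves \<pi> ! a \<in> {v \<in> leaves \<pi>. vmap \<pi> v = -\<infinity>}"
    unfolding covers_leaves(2)[OF assms(1), symmetric] using covers_leaves(3)[OF assms(1)] by simp
  then show ?thesis using 1 covers_leaves(3)[OF assms(1)] by (simp add: vlist_nth pts_nth)
next
  case (2 i)
  then show ?thesis using covers_leaves(3)[OF assms(1)] vertex_over_inner[OF assms(1)] by (simp add: vlist_nth pts_nth)
next
  case (3 j)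
  then have "right_leaves \<pi> ! j \<in> {v \<in> leaves \<pi>. vmap \<pi> v = \<infinity>}"
    unfolding covers_leaves(5)[OF assms(1), symmetric] using covers_leaves(6)[OF assms(1)] by simp
  then show ?thesis using 3 covers_leaves(3)[OF assms(1)] by (simp add: vlist_nth pts_nth)
qed

lemma distinct_vlist:
  assumes "\<pi> \<in> covers"
  shows "distinct (vlist ps \<pi>)"
proof -
  have "inj_on (vertex_over \<pi>) (set ps)"
    using vertex_over_inner(2)[OF assms] by (intro inj_onI) (metis ereal.inject in_set_conv_nth)
  moreover have "distinct ps" using sorted_ps strict_sorted_iff by blast
  moreover have "vmap \<pi> v \<noteq> \<infinity>" "vmap \<pi> v \<noteq> -\<infinity>" if "v \<in> vertex_over \<pi> ` set ps" for v
    using that vertex_over_inner(2)[OF assms] by (auto simp: in_set_conv_nth)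
  ultimately show ?thesis
    using covers_leaves(1,2,4,5)[OF assms] by (auto simp: vlist_def distinct_map)
qed

lemma layered_covers:
  assumes "\<pi> \<in> covers"
  shows "layered \<pi>"
proof -
  have "finite (edges \<pi>)"
    using assms by (simp add: leaky_covers_def is_tropical_cover_def is_tropical_curve_def)
  moreover have "0 < weight \<pi> e \<and>
       (\<exists>a<M. \<exists>b<M. bd \<pi> e = {#vlist ps \<pi> ! a, vlist ps \<pi> ! b#} \<and> pts ! a < pts ! b)" if e: "e \<in> edges \<pi>" for e
  proof -
    obtain u v where uv: "bd \<pi> e = {#u, v#}" "vmap \<pi> u < vmap \<pi> v" "0 < weight \<pi> e"
      using assms e by (auto simp: leaky_covers_def is_tropical_cover_def)
    have "set_mset (bd \<pi> e) \<subseteq> vertices \<pi>"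
      using assms e by (simp add: leaky_covers_def is_tropical_cover_def is_tropical_curve_def)
    then have "u \<in> set (vlist ps \<pi>)" "v \<in> set (vlist ps \<pi>)"
      using uv assms by (simp_all add: set_vlist)
    then obtain a b where "a < M" "b < M" "u = vlist ps \<pi> ! a" "v = vlist ps \<pi> ! b"
      using assms by (metis in_set_conv_nth length_vlist)
    then show ?thesis using uv vmap_vlist[OF assms] by auto
  qed
  ultimately show ?thesis
    using assms by (simp add: layered_def distinct_vlist length_vlist vmap_vlist)
qed

lemma incident_leaf:
  assumes "\<pi> \<in> covers" "v \<in> leaves \<pi>"
  obtains e where "{e \<in> edges \<pi>. v \<in># bd \<pi> e} = {e}"
proof -
  have "(\<Sum>e\<in>edges \<pi>. count (bd \<pi> e) v) = 1" "finite (edges \<pi>)"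
    using assms by (auto simp: leaky_covers_def is_tropical_cover_def is_tropical_curve_def valence_def)
  then obtain e where e: "e \<in> edges \<pi>" "count (bd \<pi> e) v = 1" "\<forall>e'\<in>edges \<pi>. e \<noteq> e' \<longrightarrow> count (bd \<pi> e') v = 0"
    using sum_eq_1_iff[of "edges \<pi>" "\<lambda>e. count (bd \<pi> e) v"] by auto
  have "v \<in># bd \<pi> e' \<longleftrightarrow> e' = e" if "e' \<in> edges \<pi>" for e'
    using e that by (cases "e' = e") (auto simp flip: count_greater_zero_iff)
  then have "{e \<in> edges \<pi>. v \<in># bd \<pi> e} = {e}"
    using e(1) by auto
  then show thesis by (rule that)
qed

text \<open>Nothing lies to the left of -\<infinity>, so the only edge at such a leaf is outgoing,
  and the profile prescribes its weight.\<close>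

lemma at_left_leaf:
  assumes "\<pi> \<in> covers" "a < length \<mu>"
  shows "out_at (code \<pi>) a = {#\<mu> ! a#}" "in_at (code \<pi>) a = {#}"
proof -
  note lay = layered_covers[OF assms(1)]
  have a: "a < M" using assms(2) by (simp add: M_def)
  have v: "vlist ps \<pi> ! a = left_leaves \<pi> ! a"
    using assms(2) covers_leaves(3)[OF assms(1)] by (simp add: vlist_nth)
  have "left_leaves \<pi> ! a \<in> leaves \<pi>"
    using covers_leaves(2,3)[OF assms(1)] assms(2) by (metis (mono_tags, lifting) mem_Collect_eq nth_mem)
  then have val: "valence \<pi> (left_leaves \<pi> ! a) = 1"
    using assms(1) by (simp add: leaky_covers_def is_tropical_cover_def is_tropical_curve_def)
  have "{e \<in> edges \<pi>. fst (snd (key \<pi> e)) = a} = {}"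
    using pts_nth(1)[OF assms(2)] by (auto elim!: keyE[OF lay])
  then have "in_weights \<pi> (vlist ps \<pi> ! a) = {#}"
    unfolding in_weights_def incoming_vlist[OF lay a] by (simp only: mset_set.empty image_mset_empty)
  then show i: "in_at (code \<pi>) a = {#}" by (simp add: in_weights_vlist[OF lay a])
  have "size (out_at (code \<pi>) a) = 1" using valence_vlist[OF lay a] val v i by simp
  then obtain w where w: "out_at (code \<pi>) a = {#w#}" using size_1_singleton_mset by blast
  then have "w \<in># out_weights \<pi> (left_leaves \<pi> ! a)" using out_weights_vlist[OF lay a] v by simp
  then obtain e where e: "e \<in> edges \<pi>" "left_leaves \<pi> ! a \<in># bd \<pi> e" "w = weight \<pi> e"
    using lay by (auto simp: out_weights_def outgoing_def layered_def)
  moreover have "\<forall>i<length \<mu>. \<forall>e\<in>edges \<pi>. left_leaves \<pi> ! i \<in># bd \<pi> e \<longrightarrow> weight \<pi> e = \<mu> ! i"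
    using assms(1) by (simp add: leaky_covers_def has_profile_def)
  ultimately have "w = \<mu> ! a" using assms(2) by auto
  then show "out_at (code \<pi>) a = {#\<mu> ! a#}" using w by simp
qed

lemma at_right_leaf:
  assumes "\<pi> \<in> covers" "j < length \<nu>"
  defines "a \<equiv> length \<mu> + length ps + j"
  shows "out_at (code \<pi>) a = {#}" "in_at (code \<pi>) a = {#\<nu> ! j#}"
proof -
  note lay = layered_covers[OF assms(1)]
  have a: "a < M" using assms(2) by (simp add: M_def a_def)
  have v: "vlist ps \<pi> ! a = right_leaves \<pi> ! j"
    using assms(2) covers_leaves(3)[OF assms(1)] by (simp add: vlist_nth a_def)
  have "right_leaves \<pi> ! j \<in> leaves \<pi>"
    using covers_leaves(5,6)[OF assms(1)] assms(2) by (metis (mono_tags, lifting) mem_Collect_eq nth_mem)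
  then have val: "valence \<pi> (right_leaves \<pi> ! j) = 1"
    using assms(1) by (simp add: leaky_covers_def is_tropical_cover_def is_tropical_curve_def)
  have "{e \<in> edges \<pi>. fst (key \<pi> e) = a} = {}"
    using pts_nth(3)[OF assms(2)] by (auto simp: a_def elim!: keyE[OF lay])
  then have "out_weights \<pi> (vlist ps \<pi> ! a) = {#}"
    unfolding out_weights_def outgoing_vlist[OF lay a] by (simp only: mset_set.empty image_mset_empty)
  then show i: "out_at (code \<pi>) a = {#}" by (simp add: out_weights_vlist[OF lay a])
  have "size (in_at (code \<pi>) a) = 1" using valence_vlist[OF lay a] val v i by simp
  then obtain w where w: "in_at (code \<pi>) a = {#w#}" using size_1_singleton_mset by blast
  then have "w \<in># in_weights \<pi> (right_leaves \<pi> ! j)" using in_weights_vlist[OF lay a] v by simp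
  then obtain e where e: "e \<in> edges \<pi>" "right_leaves \<pi> ! j \<in># bd \<pi> e" "w = weight \<pi> e"
    using lay by (auto simp: in_weights_def incoming_def layered_def)
  moreover have "\<forall>i<length \<nu>. \<forall>e\<in>edges \<pi>. right_leaves \<pi> ! i \<in># bd \<pi> e \<longrightarrow> weight \<pi> e = \<nu> ! i"
    using assms(1) by (simp add: leaky_covers_def has_profile_def)
  ultimately have "w = \<nu> ! j" using assms(2) by auto
  then show "in_at (code \<pi>) a = {#\<nu> ! j#}" using w by simp
qed

text \<open>Besides giving admissibility, the last equation shows that the code determines the
  vertex genera, so isomorphisms need not be tested on them.\<close>

lemma at_vertex:
  assumes "\<pi> \<in> covers" "i < length ps"
  defines "P \<equiv> out_at (code \<pi>) (length \<mu> + i)" and "Q \<equiv> in_at (code \<pi>) (length \<mu> + i)"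
    and "v \<equiv> vertex_over \<pi> (ps ! i)"
  shows "out_weights \<pi> v = P" "in_weights \<pi> v = Q" "int (sum_mset P) - int (sum_mset Q) = - (ks ! i)"
    "rs ! i + 1 = 2 * vgenus \<pi> v + (size P + size Q)"
proof -
  note lay = layered_covers[OF assms(1)]
  have a: "length \<mu> + i < M" using assms(2) by (simp add: M_def)
  have v: "vlist ps \<pi> ! (length \<mu> + i) = v"
    using assms(2) covers_leaves(3)[OF assms(1)] by (simp add: vlist_nth v_def)
  show w: "out_weights \<pi> v = P" "in_weights \<pi> v = Q"
    using out_weights_vlist[OF lay a] in_weights_vlist[OF lay a] by (simp_all add: v P_def Q_def)
  have "leakiness \<pi> v = ks ! i" "int (rs ! i) - 1 = 2 * int (vgenus \<pi> v) - 2 + int (valence \<pi> v)"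
    using assms(1,2) by (simp_all add: leaky_covers_def v_def)
  then show "int (sum_mset P) - int (sum_mset Q) = - (ks ! i)"
    "rs ! i + 1 = 2 * vgenus \<pi> v + (size P + size Q)"
    using valence_vlist[OF lay a] by (simp_all add: leakiness_def w v P_def Q_def del: of_nat_sum_mset) 
qed

lemma code_admissible:
  assumes "\<pi> \<in> covers"
  shows "code \<pi> \<in> admissible nodes"
proof -
  note lay = layered_covers[OF assms]
  have "finite (edges \<pi>)" using lay by (simp add: layered_def)
  then have "\<forall>(a, b, w)\<in>#code \<pi>. a < b \<and> b < length nodes \<and> 0 < w"
    by (auto simp: code_def length_nodes elim!: keyE[OF lay])
  moreover have "node_rel (nodes ! a) (out_at (code \<pi>) a) (in_at (code \<pi>) a)" if "a < M" for a
    using that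
  proof (cases rule: node_cases)
    case (2 i)
    then show ?thesis using at_vertex[OF assms, of i] by (auto simp: nodes_nth simp del: of_nat_sum_mset)
  qed (simp_all add: nodes_nth at_left_leaf[OF assms] at_right_leaf[OF assms])
  ultimately show ?thesis by (simp add: admissible_def length_nodes)
qed

section \<open>Isomorphisms as matchings of edges\<close>

text \<open>Leaves are fixed by their labels and inner vertices by the point over which they lie, so
  an isomorphism has no freedom on vertices.\<close>

lemma map_iso_vlist:
  assumes "\<pi> \<in> covers" "\<pi>' \<in> covers" "(\<phi>, \<psi>) \<in> cover_isos \<pi> \<pi>'"
  shows "map \<phi> (vlist ps \<pi>) = vlist ps \<pi>'"
proof -
  have "\<phi> (vertex_over \<pi> x) = vertex_over \<pi>' x" if x: "x \<in> set ps" for x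
  proof -
    obtain i where i: "i < length ps" "x = ps ! i" using x by (metis in_set_conv_nth)
    note v = vertex_over_inner[OF assms(1) i(1)]
    have "\<phi> (vertex_over \<pi> x) \<in> inner \<pi>'"
      using v assms(3) by (auto simp: cover_isos_def bij_betw_def i(2))
    moreover have "vmap \<pi>' (\<phi> (vertex_over \<pi> x)) = ereal (ps ! i)"
      using v assms(3) by (auto simp: cover_isos_def i(2) vertices_def)
    ultimately show ?thesis
      using vertex_over_eqI[OF assms(2) i(1), of "\<phi> (vertex_over \<pi> x)"] by (simp add: i(2) vertices_def)
  qed
  then show ?thesis
    using assms(3) by (simp add: vlist_def cover_isos_def)
qed

definition vertex_map :: "(nat, nat) tropical_cover \<Rightarrow> (nat, nat) tropical_cover \<Rightarrow> nat \<Rightarrow> nat" where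
  "vertex_map \<pi> \<pi>' = restrict (\<lambda>v. the (map_of (zip (vlist ps \<pi>) (vlist ps \<pi>')) v)) (vertices \<pi>)"

lemma map_vertex_map:
  assumes "\<pi> \<in> covers" "\<pi>' \<in> covers"
  shows "map (vertex_map \<pi> \<pi>') (vlist ps \<pi>) = vlist ps \<pi>'"
proof (rule nth_equalityI)
  fix a assume "a < length (map (vertex_map \<pi> \<pi>') (vlist ps \<pi>))"
  then have a: "a < M" using assms by (simp add: length_vlist)
  then have "vlist ps \<pi> ! a \<in> vertices \<pi>"
    using assms by (metis length_vlist nth_mem set_vlist)
  then show "map (vertex_map \<pi> \<pi>') (vlist ps \<pi>) ! a = vlist ps \<pi>' ! a"
    using a assms by (simp add: vertex_map_def length_vlist map_of_zip_nth distinct_vlist)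
qed (simp add: assms length_vlist)

lemma matchings_code_eq:
  assumes "layered \<pi>" "\<psi> \<in> matchings (key \<pi>) (edges \<pi>) (key \<pi>') (edges \<pi>')"
  shows "code \<pi>' = code \<pi>"
proof -
  have \<psi>: "bij_betw \<psi> (edges \<pi>) (edges \<pi>')" "\<forall>e\<in>edges \<pi>. key \<pi>' (\<psi> e) = key \<pi> e"
    using assms(2) by (auto simp: matchings_def)
  have "mset_set (edges \<pi>') = image_mset \<psi> (mset_set (edges \<pi>))"
    using \<psi>(1) by (metis bij_betw_def image_mset_mset_set)
  then show ?thesis
    using assms(1) \<psi>(2) by (auto simp: code_def multiset.map_comp layered_def intro!: image_mset_cong)
qed

lemma ereal_len_unique:
  assumes "ereal (real w) * l = ereal (real w) * l'" "0 < w"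
  shows "l = l'"
  using assms by (simp add: ereal_mult_cancel_left)

text \<open>Edges with equal keys agree in all that an isomorphism must preserve: end points and
  weight are part of the key, and the length is forced by the weight and the images of the end
  points.\<close>

lemma cover_isos_eq:
  assumes \<pi>: "\<pi> \<in> covers" and \<pi>': "\<pi>' \<in> covers"
  shows "cover_isos \<pi> \<pi>' = {vertex_map \<pi> \<pi>'} \<times> matchings (key \<pi>) (edges \<pi>) (key \<pi>') (edges \<pi>')"
proof (intro equalityI subsetI)
  note lay = layered_covers[OF \<pi>] and lay' = layered_covers[OF \<pi>']
  fix x assume "x \<in> cover_isos \<pi> \<pi>'"
  moreover obtain \<phi> \<psi> where x: "x = (\<phi>, \<psi>)" by fastforce
  ultimately have iso: "(\<phi>, \<psi>) \<in> cover_isos \<pi> \<pi>'" by simp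
  note V = map_iso_vlist[OF \<pi> \<pi>' iso]
  have "\<phi> = vertex_map \<pi> \<pi>'"
  proof (rule extensionalityI)
    show "\<phi> \<in> extensional (vertices \<pi>)" using iso by (simp add: cover_isos_def)
    show "vertex_map \<pi> \<pi>' \<in> extensional (vertices \<pi>)" by (simp add: vertex_map_def)
    have "map \<phi> (vlist ps \<pi>) = map (vertex_map \<pi> \<pi>') (vlist ps \<pi>)"
      by (simp only: V map_vertex_map[OF \<pi> \<pi>'])
    then show "\<phi> v = vertex_map \<pi> \<pi>' v" if "v \<in> vertices \<pi>" for v
      using that set_vlist[OF \<pi>] by (metis map_eq_conv)
  qed
  moreover have "\<psi> \<in> matchings (key \<pi>) (edges \<pi>) (key \<pi>') (edges \<pi>')"
  proof -
    have "key \<pi>' (\<psi> e) = key \<pi> e" if e: "e \<in> edges \<pi>" for e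
      using keyE[OF lay e]
    proof cases
      case (1 a b)
      have "bd \<pi>' (\<psi> e) = {#\<phi> (vlist ps \<pi> ! a), \<phi> (vlist ps \<pi> ! b)#}" "weight \<pi>' (\<psi> e) = weight \<pi> e"
        using iso e 1 by (auto simp: cover_isos_def)
      moreover have "\<phi> (vlist ps \<pi> ! a) = vlist ps \<pi>' ! a" "\<phi> (vlist ps \<pi> ! b) = vlist ps \<pi>' ! b"
        using 1 \<pi> by (simp_all add: V[symmetric] length_vlist)
      ultimately have "is_key \<pi>' (\<psi> e) (a, b, weight \<pi> e)"
        using 1 by (simp add: is_key_def)
      from key_eqI[OF lay' this] show ?thesis using 1 by simp
    qed
    then show ?thesis using iso by (auto simp: matchings_def cover_isos_def)
  qed
  ultimately show "x \<in> {vertex_map \<pi> \<pi>'} \<times> matchings (key \<pi>) (edges \<pi>) (key \<pi>') (edges \<pi>')"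
    by (simp add: x)
next
  note lay = layered_covers[OF \<pi>] and lay' = layered_covers[OF \<pi>']
  fix x assume "x \<in> {vertex_map \<pi> \<pi>'} \<times> matchings (key \<pi>) (edges \<pi>) (key \<pi>') (edges \<pi>')"
  then obtain \<psi> where x: "x = (vertex_map \<pi> \<pi>', \<psi>)" and \<psi>: "\<psi> \<in> matchings (key \<pi>) (edges \<pi>) (key \<pi>') (edges \<pi>')"
    by blast
  define \<phi> where "\<phi> = vertex_map \<pi> \<pi>'"
  have V: "map \<phi> (vlist ps \<pi>) = vlist ps \<pi>'"
    unfolding \<phi>_def by (rule map_vertex_map[OF \<pi> \<pi>'])
  have nth: "\<phi> (vlist ps \<pi> ! a) = vlist ps \<pi>' ! a" if "a < M" for a
    using that \<pi> by (simp add: V[symmetric] length_vlist)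
  have lists: "map \<phi> (left_leaves \<pi>) = left_leaves \<pi>'" "map \<phi> (map (vertex_over \<pi>) ps) = map (vertex_over \<pi>') ps"
     "map \<phi> (right_leaves \<pi>) = right_leaves \<pi>'"
    using V covers_leaves(3,6)[OF \<pi>] covers_leaves(3,6)[OF \<pi>'] by (simp_all add: vlist_def)
  have inj: "inj_on \<phi> (vertices \<pi>)"
    using V distinct_vlist[OF \<pi>'] set_vlist[OF \<pi>] by (metis distinct_map)
  have leaves: "\<phi> ` leaves \<pi> = leaves \<pi>'"
    unfolding covers_leaves(7)[OF \<pi>] covers_leaves(7)[OF \<pi>'] lists(1,3)[symmetric] by auto
  have inner: "\<phi> ` inner \<pi> = inner \<pi>'"
    unfolding covers_inner[OF \<pi>] covers_inner[OF \<pi>'] using lists(2) by (metis list.set_map)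
  \<comment> \<open>Equal codes give equal vertex genera through
    \<open>at_vertex(4)\<close>.\<close>
  have code: "code \<pi>' = code \<pi>" by (rule matchings_code_eq[OF lay \<psi>])
  have "bij_betw \<phi> (leaves \<pi>) (leaves \<pi>')" "bij_betw \<phi> (inner \<pi>) (inner \<pi>')"
    using inj leaves inner by (auto simp: bij_betw_def vertices_def inj_on_Un)
  moreover have "bd \<pi>' (\<psi> e) = image_mset \<phi> (bd \<pi> e) \<and> len \<pi>' (\<psi> e) = len \<pi> e \<and> weight \<pi>' (\<psi> e) = weight \<pi> e"
    if e: "e \<in> edges \<pi>" for e
  proof -
    have e': "\<psi> e \<in> edges \<pi>'" and k: "key \<pi>' (\<psi> e) = key \<pi> e"
      using \<psi> e by (auto simp: matchings_def bij_betw_def)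
    obtain a b where ab: "key \<pi> e = (a, b, weight \<pi> e)" "a < b" "b < M" "pts ! a < pts ! b"
      "bd \<pi> e = {#vlist ps \<pi> ! a, vlist ps \<pi> ! b#}" "0 < weight \<pi> e"
      by (rule keyE[OF lay e])
    obtain a' b' where ab': "key \<pi>' (\<psi> e) = (a', b', weight \<pi>' (\<psi> e))"
      "bd \<pi>' (\<psi> e) = {#vlist ps \<pi>' ! a', vlist ps \<pi>' ! b'#}"
      by (rule keyE[OF lay' e'])
    have eq: "a' = a" "b' = b" "weight \<pi>' (\<psi> e) = weight \<pi> e"
      using k ab(1) ab'(1) by simp_all
    \<comment> \<open>Images increase from u to v and from a to b, so the unordered pair can be read
      in one way only. Cancelling the weight is sound even for infinite lengths, as it is finite and
      positive.\<close>
    have len: "pts ! b - pts ! a = ereal (real (weight \<rho> f)) * len \<rho> f"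
      if \<rho>: "\<rho> \<in> covers" and f: "f \<in> edges \<rho>" and bd: "bd \<rho> f = {#vlist ps \<rho> ! a, vlist ps \<rho> ! b#}" for \<rho> f
    proof -
      obtain u v where "bd \<rho> f = {#u, v#}" "vmap \<rho> u < vmap \<rho> v"
        "vmap \<rho> v - vmap \<rho> u = ereal (real (weight \<rho> f)) * len \<rho> f"
        using \<rho> f by (auto simp: leaky_covers_def is_tropical_cover_def)
      then show ?thesis
        using bd ab(2-4) vmap_vlist[OF \<rho>, of a] vmap_vlist[OF \<rho>, of b] by (auto simp: pair_mset_eq_iff)
    qed
    have "len \<pi>' (\<psi> e) = len \<pi> e"
      using len[OF \<pi> e ab(5)] len[OF \<pi>' e'] ab'(2) eq ab(6) by (metis ereal_len_unique)
    then show ?thesis using ab(2,3,5) ab'(2) eq nth by simp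
  qed
  moreover have "vmap \<pi>' (\<phi> v) = vmap \<pi> v" if "v \<in> vertices \<pi>" for v
  proof -
    obtain a where "a < M" "v = vlist ps \<pi> ! a"
      using \<open>v \<in> vertices \<pi>\<close> set_vlist[OF \<pi>] length_vlist[OF \<pi>] by (metis in_set_conv_nth)
    then show ?thesis using nth vmap_vlist[OF \<pi>] vmap_vlist[OF \<pi>'] by simp
  qed
  moreover have "vgenus \<pi>' (\<phi> v) = vgenus \<pi> v" if "v \<in> inner \<pi>" for v
  proof -
    obtain i where i: "i < length ps" "v = vertex_over \<pi> (ps ! i)"
      using \<open>v \<in> inner \<pi>\<close> covers_inner[OF \<pi>] by (auto simp: in_set_conv_nth)
    have "\<phi> v = vertex_over \<pi>' (ps ! i)"
      using lists(2) i by (metis length_map nth_map)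
    then show ?thesis
      using at_vertex(4)[OF \<pi> i(1)] at_vertex(4)[OF \<pi>' i(1)] by (simp add: code i(2))
  qed
  moreover have "\<phi> \<in> extensional (vertices \<pi>)" by (simp add: \<phi>_def vertex_map_def)
  ultimately show "x \<in> cover_isos \<pi> \<pi>'"
    using \<psi> lists unfolding x \<phi>_def[symmetric] by (simp add: cover_isos_def matchings_def)
qed

lemma card_Aut:
  assumes "\<pi> \<in> covers"
  shows "card (Aut \<pi>) = mfact (code \<pi>)"
proof -
  have "finite (edges \<pi>)" using layered_covers[OF assms] by (simp add: layered_def)
  then show ?thesis
    unfolding Aut_def cover_isos_eq[OF assms assms] by (simp add: card_cartesian_product card_matchings code_def)
qed

text \<open>For equal codes a matching exists because the number of matchings is a product of
  factorials, hence nonzero.\<close>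

lemma isomorphic_covers_iff:
  assumes "\<pi> \<in> covers" "\<pi>' \<in> covers"
  shows "(\<pi>, \<pi>') \<in> isomorphic_covers \<longleftrightarrow> code \<pi> = code \<pi>'"
proof
  assume "(\<pi>, \<pi>') \<in> isomorphic_covers"
  then obtain \<psi> where "\<psi> \<in> matchings (key \<pi>) (edges \<pi>) (key \<pi>') (edges \<pi>')"
    by (auto simp: isomorphic_covers_def cover_isos_eq[OF assms])
  then show "code \<pi> = code \<pi>'"
    using matchings_code_eq[OF layered_covers[OF assms(1)]] by metis
next
  assume "code \<pi> = code \<pi>'"
  moreover have "finite (edges \<pi>)" "finite (edges \<pi>')"
    using assms layered_covers by (simp_all add: layered_def)
  ultimately have "card (matchings (key \<pi>) (edges \<pi>) (key \<pi>') (edges \<pi>')) = mfact (code \<pi>)"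
    by (simp add: card_matchings code_def)
  then have "matchings (key \<pi>) (edges \<pi>) (key \<pi>') (edges \<pi>') \<noteq> {}"
    by (metis card.empty mfact_pos)
  then show "(\<pi>, \<pi>') \<in> isomorphic_covers"
    by (simp add: isomorphic_covers_def cover_isos_eq[OF assms])
qed

section \<open>A cover with a prescribed code\<close>

text \<open>Edges are positions in a list, so that equal triples become distinct parallel edges;
  vertices are the node numbers themselves. Length and genus are solved from the slope and valence
  equations, and for admissible codes the division by 2 is exact.\<close>

definition cover_of :: "(nat \<times> nat \<times> nat) list \<Rightarrow> (nat, nat) tropical_cover" where
  "cover_of xs = \<lparr>leaves = {..<length \<mu>} \<union> {length \<mu> + length ps..<M},
     inner = {length \<mu>..<length \<mu> + length ps}, edges = {..<length xs},
     bd = (\<lambda>e. {#fst (xs ! e), fst (snd (xs ! e))#}),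
     len = (\<lambda>e. (pts ! fst (snd (xs ! e)) - pts ! fst (xs ! e)) / ereal (real (snd (snd (xs ! e))))),
     vgenus = (\<lambda>a. (rs ! (a - length \<mu>) + 1 - (size (out_at (mset xs) a) + size (in_at (mset xs) a))) div 2),
     vmap = (\<lambda>a. pts ! a), weight = (\<lambda>e. snd (snd (xs ! e))),
     left_leaves = [0..<length \<mu>], right_leaves = [length \<mu> + length ps..<M]\<rparr>"

lemma cover_of_simps [simp]:
  "leaves (cover_of xs) = {..<length \<mu>} \<union> {length \<mu> + length ps..<M}"
  "inner (cover_of xs) = {length \<mu>..<length \<mu> + length ps}" "edges (cover_of xs) = {..<length xs}"
  "bd (cover_of xs) e = {#fst (xs ! e), fst (snd (xs ! e))#}"
  "len (cover_of xs) e = (pts ! fst (snd (xs ! e)) - pts ! fst (xs ! e)) / ereal (real (snd (snd (xs ! e))))"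
  "vgenus (cover_of xs) a = (rs ! (a - length \<mu>) + 1 - (size (out_at (mset xs) a) + size (in_at (mset xs) a))) div 2"
  "vmap (cover_of xs) a = pts ! a" "weight (cover_of xs) e = snd (snd (xs ! e))"
  "left_leaves (cover_of xs) = [0..<length \<mu>]" "right_leaves (cover_of xs) = [length \<mu> + length ps..<M]"
  by (simp_all add: cover_of_def)

lemma vertices_cover_of: "vertices (cover_of xs) = {..<M}"
  by (auto simp: vertices_def M_def)

lemma valence_cover_of:
  "valence (cover_of xs) v = size (out_at (mset xs) v) + size (in_at (mset xs) v)"
proof -
  have "valence (cover_of xs) v = (\<Sum>e<length xs. (\<lambda>x. count {#fst x, fst (snd x)#} v) (xs ! e))"
    by (simp add: valence_def)
  also have "\<dots> = (\<Sum>x\<leftarrow>xs. count {#fst x, fst (snd x)#} v)"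
    unfolding sum_list_sum_nth length_map atLeast0LessThan by (intro sum.cong) simp_all
  finally show ?thesis by (simp only: sum_list_incidence)
qed

lemma pts_nth_ge:
  "length \<mu> \<le> v \<Longrightarrow> v < length \<mu> + length ps \<Longrightarrow> pts ! v = ereal (ps ! (v - length \<mu>))"
  "length \<mu> + length ps \<le> v \<Longrightarrow> v < M \<Longrightarrow> pts ! v = \<infinity>"
  using pts_nth(2)[of "v - length \<mu>"] pts_nth(3)[of "v - (length \<mu> + length ps)"]
  by (simp_all add: M_def less_diff_conv2)

lemma pts_eq_ereal_iff:
  assumes "i < length ps" "v < M"
  shows "pts ! v = ereal (ps ! i) \<longleftrightarrow> v = length \<mu> + i"
  using assms(2)
proof (cases rule: node_cases)
  case (2 k)
  have "distinct ps" using sorted_ps strict_sorted_iff by blast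
  then show ?thesis using 2 assms(1) by (simp add: pts_nth nth_eq_iff_index_eq)
qed (use assms(1) in \<open>simp_all add: pts_nth\<close>)

lemma vertex_over_cover_of:
  assumes "i < length ps"
  shows "vertex_over (cover_of xs) (ps ! i) = length \<mu> + i"
  unfolding vertex_over_def vertices_cover_of
  using assms by (intro the_equality) (auto simp: pts_eq_ereal_iff pts_nth M_def)

lemma vlist_cover_of: "vlist ps (cover_of xs) = [0..<M]"
proof -
  have "map (vertex_over (cover_of xs)) ps = [length \<mu>..<length \<mu> + length ps]"
    by (rule nth_equalityI) (simp_all add: vertex_over_cover_of)
  moreover have "[0..<length \<mu> + (length ps + length \<nu>)] = [0..<length \<mu>] @ [length \<mu>..<length \<mu> + (length ps + length \<nu>)]"
    "[length \<mu>..<(length \<mu> + length ps) + length \<nu>] =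
      [length \<mu>..<length \<mu> + length ps] @ [length \<mu> + length ps..<(length \<mu> + length ps) + length \<nu>]"
    by (rule upt_add_eq_append; simp)+
  ultimately show ?thesis
    by (simp add: vlist_def M_def add.assoc)
qed

text \<open>\<open>pts\<close> is constant on the leaves of one side, so a < b alone does not give
  distinct images. A sink has no outgoing and a source no incoming edge, which rules out edges
  between leaves of the same side.\<close>

lemma admissible_edge:
  assumes "mset xs \<in> admissible nodes" "e < length xs"
  obtains a b w where "xs ! e = (a, b, w)" "a < b" "b < M" "0 < w" "a < length \<mu> + length ps" "length \<mu> \<le> b"
    "pts ! a < pts ! b" "w \<in># out_at (mset xs) a" "w \<in># in_at (mset xs) b"
proof -
  obtain a b w where x: "xs ! e = (a, b, w)" by (metis prod.exhaust)
  then have mem: "(a, b, w) \<in># mset xs" using assms(2) by (metis nth_mem set_mset_mset)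
  then have *: "a < b" "b < M" "0 < w"
    using assms(1) by (auto simp: admissible_def length_nodes)
  have rel: "node_rel (nodes ! c) (out_at (mset xs) c) (in_at (mset xs) c)" if "c < M" for c
    using assms(1) that by (simp add: admissible_def length_nodes)
  have out: "w \<in># out_at (mset xs) a" and inn: "w \<in># in_at (mset xs) b"
    using mem by (force simp: out_at_def in_at_def)+
  have a: "a < length \<mu> + length ps"
  proof (rule ccontr)
    assume "\<not> a < length \<mu> + length ps"
    moreover have "a < M" using * by simp
    ultimately obtain j where "j < length \<nu>" "a = length \<mu> + length ps + j"
      by (elim node_cases) auto
    then show False using rel[OF \<open>a < M\<close>] out by (simp add: nodes_nth)
  qed
  have b: "length \<mu> \<le> b"
    using rel[OF *(2)] inn by (cases "b < length \<mu>") (simp_all add: nodes_nth)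
  have "pts ! a < pts ! b"
  proof -
    have "pts ! a \<le> pts ! b"
      using * by (intro sorted_nth_mono[OF sorted_pts]) (simp_all add: length_pts)
    moreover have "pts ! a \<noteq> pts ! b"
    proof
      assume eq: "pts ! a = pts ! b"
      show False
      proof (cases "a < length \<mu>")
        case True
        show False using *(2)
        proof (cases rule: node_cases)
          case 1 then show False using b by simp
        qed (use True eq in \<open>simp_all add: pts_nth\<close>)
      next
        case False
        define i where "i = a - length \<mu>"
        have i: "i < length ps" "a = length \<mu> + i" using False a by (simp_all add: i_def)
        then have "b = a" using pts_eq_ereal_iff[OF i(1) *(2)] eq by (simp add: pts_nth)
        then show False using * by simp
      qed
    qed
    ultimately show ?thesis by simp
  qed
  then show thesis using that[OF x * a b _ out inn] by simp
qed

lemma layered_cover_of: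
  assumes "mset xs \<in> admissible nodes"
  shows "layered (cover_of xs)"
proof -
  have "0 < weight (cover_of xs) e \<and> (\<exists>a<M. \<exists>b<M. bd (cover_of xs) e =
      {#vlist ps (cover_of xs) ! a, vlist ps (cover_of xs) ! b#} \<and> pts ! a < pts ! b)"
    if e: "e < length xs" for e
  proof -
    obtain a b w where "xs ! e = (a, b, w)" "a < b" "b < M" "0 < w" "pts ! a < pts ! b"
      using admissible_edge[OF assms e] by metis
    then have "a < M" "b < M" "pts ! a < pts ! b" "0 < weight (cover_of xs) e"
      "bd (cover_of xs) e = {#vlist ps (cover_of xs) ! a, vlist ps (cover_of xs) ! b#}"
      by (simp_all add: vlist_cover_of)
    then show ?thesis by blast
  qed
  then show ?thesis by (simp add: layered_def vlist_cover_of)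
qed

lemma code_cover_of:
  assumes "mset xs \<in> admissible nodes"
  shows "code (cover_of xs) = mset xs"
proof -
  have "key (cover_of xs) e = xs ! e" if e: "e < length xs" for e
  proof -
    obtain a b w where "xs ! e = (a, b, w)" "a < b" "b < M"
      using admissible_edge[OF assms e] by metis
    then have "is_key (cover_of xs) e (xs ! e)"
      by (simp add: is_key_def vlist_cover_of)
    then show ?thesis by (rule key_eqI[OF layered_cover_of[OF assms]])
  qed
  then have "code (cover_of xs) = image_mset ((!) xs) (mset_set {..<length xs})"
    by (auto simp: code_def intro!: image_mset_cong)
  also have "\<dots> = mset (map ((!) xs) [0..<length xs])"
    by (simp add: atLeast0LessThan)
  finally show ?thesis by (simp only: map_nth)
qed

lemma valence_leaf_cover_of:
  assumes "mset xs \<in> admissible nodes" "v \<in> leaves (cover_of xs)"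
  shows "valence (cover_of xs) v = 1"
proof -
  have v: "v < M" using assms(2) by (auto simp: M_def)
  then have "node_rel (nodes ! v) (out_at (mset xs) v) (in_at (mset xs) v)"
    using assms(1) by (simp add: admissible_def length_nodes)
  then show ?thesis using v assms(2)
    by (cases rule: node_cases[OF v]) (auto simp: valence_cover_of nodes_nth)
qed

lemma is_tropical_curve_cover_of:
  assumes "mset xs \<in> admissible nodes"
  shows "is_tropical_curve (cover_of xs)"
proof -
  have "0 < len (cover_of xs) e \<and> (len (cover_of xs) e = \<infinity> \<longleftrightarrow> e \<in> ends (cover_of xs)) \<and>
     set_mset (bd (cover_of xs) e) \<subseteq> {..<M}" if e: "e < length xs" for e
  proof -
    obtain a b w where ab: "xs ! e = (a, b, w)" "a < b" "b < M" "0 < w" "a < length \<mu> + length ps" "length \<mu> \<le> b"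
       "pts ! a < pts ! b"
      using admissible_edge[OF assms e] by metis
    \<comment> \<open>\<open>pts\<close> is finite exactly on the inner nodes, so an edge has
      infinite length exactly if one of its end points is a leaf.\<close>
    have "e \<in> ends (cover_of xs) \<longleftrightarrow> a < length \<mu> \<or> length \<mu> + length ps \<le> b"
      using ab e by (auto simp: ends_def)
    moreover have "pts ! a = -\<infinity> \<longleftrightarrow> a < length \<mu>"
      using ab(5) pts_nth(1)[of a] pts_nth_ge(1)[of a] by (cases "a < length \<mu>") simp_all
    moreover have "pts ! b = \<infinity> \<longleftrightarrow> length \<mu> + length ps \<le> b"
      using ab(3,6) pts_nth_ge[of b] by (cases "length \<mu> + length ps \<le> b") simp_all
    ultimately show ?thesis using ab
      by (cases "pts ! a"; cases "pts ! b") auto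
  qed
  then show ?thesis
    using valence_leaf_cover_of[OF assms] unfolding is_tropical_curve_def vertices_cover_of by auto
qed

lemma is_tropical_cover_cover_of:
  assumes "mset xs \<in> admissible nodes"
  shows "is_tropical_cover ps (cover_of xs)"
proof -
  have "pts ! v \<in> {-\<infinity>, \<infinity>}" if "v \<in> leaves (cover_of xs)" for v
    using that pts_nth(1)[of v] pts_nth_ge(2)[of v] by auto
  moreover have "pts ! v \<in> ereal ` set ps" if "v \<in> inner (cover_of xs)" for v
    using that pts_nth_ge(1)[of v] by auto
  moreover have "0 < weight (cover_of xs) e \<and> (\<exists>a b. bd (cover_of xs) e = {#a, b#} \<and> pts ! a < pts ! b \<and>
      pts ! b - pts ! a = ereal (real (weight (cover_of xs) e)) * len (cover_of xs) e)" if e: "e < length xs" for e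
  proof -
    obtain a b w where ab: "xs ! e = (a, b, w)" "0 < w" "pts ! a < pts ! b"
      using admissible_edge[OF assms e] by metis
    then have "bd (cover_of xs) e = {#a, b#}" "0 < weight (cover_of xs) e"
      "pts ! b - pts ! a = ereal (real (weight (cover_of xs) e)) * len (cover_of xs) e"
      using ereal_divide_mult_cancel[of "real w" "pts ! b - pts ! a"] by simp_all
    then show ?thesis using ab(3) by blast
  qed
  ultimately show ?thesis
    using is_tropical_curve_cover_of[OF assms] by (simp add: is_tropical_cover_def)
qed

lemma sum_valence_cover_of:
  assumes "mset xs \<in> admissible nodes"
  shows "(\<Sum>v<M. valence (cover_of xs) v) = 2 * length xs"
proof -
  have "(\<Sum>v<M. count {#fst (xs ! e), fst (snd (xs ! e))#} v) = 2" if e: "e < length xs" for e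
  proof -
    obtain a b w where ab: "xs ! e = (a, b, w)" "a < b" "b < M"
      using admissible_edge[OF assms e] by metis
    have "(\<Sum>v<M. count {#a, b#} v) = (\<Sum>v<M. (if v = a then 1 else 0) + (if v = b then 1 else 0))"
      using ab by (intro sum.cong) auto
    also have "\<dots> = 2" using ab by (simp add: sum.distrib)
    finally show ?thesis by (simp add: ab)
  qed
  then have "(\<Sum>e<length xs. \<Sum>v<M. count (bd (cover_of xs) e) v) = 2 * length xs"
    by simp
  then show ?thesis
    unfolding valence_def by (subst sum.swap) simp
qed

lemma cover_of_vertex:
  assumes "mset xs \<in> admissible nodes" "i < length ps"
  shows "leakiness (cover_of xs) (length \<mu> + i) = ks ! i"
    "int (rs ! i) - 1 = 2 * int (vgenus (cover_of xs) (length \<mu> + i)) - 2 + int (valence (cover_of xs) (length \<mu> + i))"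
proof -
  let ?a = "length \<mu> + i"
  have a: "?a < M" using assms(2) by (simp add: M_def)
  then have "node_rel (nodes ! ?a) (out_at (mset xs) ?a) (in_at (mset xs) ?a)"
    using assms(1) by (simp add: admissible_def length_nodes)
  then have r: "int (sum_mset (out_at (mset xs) ?a)) - int (sum_mset (in_at (mset xs) ?a)) = - (ks ! i)"
    "\<exists>h. rs ! i + 1 = 2 * h + (size (out_at (mset xs) ?a) + size (in_at (mset xs) ?a))"
    by (simp_all add: nodes_nth(2)[OF assms(2)] del: of_nat_sum_mset)
  have lay: "layered (cover_of xs)" by (rule layered_cover_of[OF assms(1)])
  show "leakiness (cover_of xs) ?a = ks ! i"
    using out_weights_vlist[OF lay a] in_weights_vlist[OF lay a] r(1) a
    by (simp add: leakiness_def vlist_cover_of code_cover_of[OF assms(1)] del: of_nat_sum_mset)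
  show "int (rs ! i) - 1 = 2 * int (vgenus (cover_of xs) ?a) - 2 + int (valence (cover_of xs) ?a)"
    using r(2) by (auto simp: valence_cover_of)
qed

text \<open>The valences add up to twice the number of edges, each leaf contributing 1. Inserting
  the valence equation of every inner vertex into \<open>Riemann_Hurwitz\<close> then yields the
  genus.\<close>

lemma curve_genus_cover_of:
  assumes "mset xs \<in> admissible nodes"
  shows "curve_genus (cover_of xs) = int g"
proof -
  let ?c = "cover_of xs" and ?p = "length \<mu>" and ?s = "length ps"
  have "(\<Sum>v<M. valence ?c v) = (\<Sum>v<?p. valence ?c v) + (\<Sum>i<?s. valence ?c (?p + i)) + (\<Sum>j<length \<nu>. valence ?c (?p + ?s + j))"
    unfolding M_def sum_lessThan_add ..
  also have "(\<Sum>v<?p. valence ?c v) = ?p"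
    by (simp add: valence_leaf_cover_of[OF assms])
  also have "(\<Sum>j<length \<nu>. valence ?c (?p + ?s + j)) = length \<nu>"
    by (simp add: valence_leaf_cover_of[OF assms] M_def)
  finally have val: "2 * length xs = ?p + (\<Sum>i<?s. valence ?c (?p + i)) + length \<nu>"
    by (simp only: sum_valence_cover_of[OF assms])
  have "(\<Sum>i<?s. int (rs ! i) - 1) = (\<Sum>i<?s. 2 * int (vgenus ?c (?p + i)) - 2 + int (valence ?c (?p + i)))"
    using cover_of_vertex(2)[OF assms] by (intro sum.cong) auto
  also have "\<dots> = 2 * (\<Sum>i<?s. int (vgenus ?c (?p + i))) - 2 * int ?s + int (\<Sum>i<?s. valence ?c (?p + i))"
    by (simp add: sum.distrib sum_subtractf sum_distrib_left)
  finally have rh: "2 * int g - 2 + int ?p + int (length \<nu>) =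
      2 * (\<Sum>i<?s. int (vgenus ?c (?p + i))) - 2 * int ?s + int (\<Sum>i<?s. valence ?c (?p + i))"
    using Riemann_Hurwitz by simp
  have "(\<Sum>v\<in>inner ?c. int (vgenus ?c v)) = (\<Sum>i<?s. int (vgenus ?c (?p + i)))"
    by (rule sum.reindex_bij_witness[of _ "\<lambda>i. ?p + i" "\<lambda>v. v - ?p"]) auto
  \<comment> \<open>The numbers of components in \<open>first_betti\<close> and
    \<open>curve_genus\<close> cancel, so the connectivity of the graph never has to be
    determined.\<close>
  then have "curve_genus ?c = int (length xs) - int M + 1 + (\<Sum>i<?s. int (vgenus ?c (?p + i)))"
    unfolding curve_genus_def first_betti_def vertices_cover_of by simp
  moreover have "2 * int (length xs) = int ?p + int (\<Sum>i<?s. valence ?c (?p + i)) + int (length \<nu>)"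
    using arg_cong[OF val, of int] by (simp del: of_nat_sum)
  ultimately show ?thesis using rh by (simp add: M_def del: of_nat_sum)
qed

lemma cover_of_in_covers:
  assumes "mset xs \<in> admissible nodes"
  shows "cover_of xs \<in> leaky_covers ps g \<mu> \<nu> ks rs"
proof -
  have rel: "node_rel (nodes ! a) (out_at (mset xs) a) (in_at (mset xs) a)" if "a < M" for a
    using assms that by (simp add: admissible_def length_nodes)
  have inf: "pts ! v \<noteq> \<infinity>" "pts ! v \<noteq> - \<infinity>" if "v \<in> {length \<mu>..<length \<mu> + length ps}" for v
    using that pts_nth_ge(1)[of v] by auto
  have left: "has_profile (cover_of xs) (-\<infinity>) (left_leaves (cover_of xs)) \<mu>"
  proof -
    have "weight (cover_of xs) e = \<mu> ! i" if "i < length \<mu>" "e < length xs" "i \<in># bd (cover_of xs) e" for i e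
      using admissible_edge[OF assms that(2)]
    proof cases
      case (1 a b w)
      then have "a = i" using that by auto
      then show ?thesis using rel[of a] 1 that by (simp add: nodes_nth)
    qed
    moreover have "pts ! v \<noteq> - \<infinity>" if "length \<mu> + length ps \<le> v" "v < M" for v
      using that pts_nth_ge(2)[of v] by simp
    ultimately show ?thesis by (auto simp: has_profile_def pts_nth)
  qed
  have right: "has_profile (cover_of xs) \<infinity> (right_leaves (cover_of xs)) \<nu>"
  proof -
    have "weight (cover_of xs) e = \<nu> ! j" if "j < length \<nu>" "e < length xs" "length \<mu> + length ps + j \<in># bd (cover_of xs) e" for j e
      using admissible_edge[OF assms that(2)]
    proof cases
      case (1 a b w)
      then have "b = length \<mu> + length ps + j" using that by auto
      then show ?thesis using rel[of b] 1 that by (simp add: nodes_nth)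
    qed
    moreover have "pts ! v = \<infinity>" if "length \<mu> + length ps \<le> v" "v < M" for v
      using that pts_nth_ge(2)[of v] by simp
    ultimately show ?thesis by (auto simp: has_profile_def pts_nth M_def)
  qed
  have "\<exists>!v. v \<in> vertices (cover_of xs) \<and> vmap (cover_of xs) v = ereal (ps ! i)" if "i < length ps" for i
    using pts_eq_ereal_iff[OF that] that by (auto simp: vertices_cover_of M_def intro!: ex1I[of _ "length \<mu> + i"])
  then show ?thesis
    using is_tropical_cover_cover_of[OF assms] left right cover_of_vertex[OF assms] curve_genus_cover_of[OF assms]
    by (simp add: leaky_covers_def vertex_over_cover_of del: cover_of_simps)
qed

section \<open>Edge weights and vertex multiplicities\<close>

lemma prod_weights_code:
  assumes "layered \<pi>"
  shows "(\<Prod>(a, b, w)\<in>#code \<pi>. of_nat w) = (\<Prod>e\<in>edges \<pi>. of_nat (weight \<pi> e) :: complex)"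
proof -
  have "(\<Prod>(a, b, w)\<in>#code \<pi>. of_nat w) = (\<Prod>e\<in>edges \<pi>. of_nat (snd (snd (key \<pi> e))) :: complex)"
    by (simp add: code_def multiset.map_comp o_def case_prod_unfold prod_unfold_prod_mset)
  also have "\<dots> = (\<Prod>e\<in>edges \<pi>. of_nat (weight \<pi> e))"
    by (intro prod.cong) (simp_all add: snd_snd_key[OF assms])
  finally show ?thesis .
qed

lemma prod_leaf_weights:
  fixes \<mu>' :: "nat list"
  assumes "\<pi> \<in> covers" "has_profile \<pi> y vs \<mu>'"
  shows "(\<Prod>v\<in>set vs. \<Prod>e | e \<in> edges \<pi> \<and> v \<in># bd \<pi> e. weight \<pi> e) = prod_list \<mu>'"
proof -
  have vs: "distinct vs" "set vs \<subseteq> leaves \<pi>" "length vs = length \<mu>'"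
    and w: "\<And>i e. i < length \<mu>' \<Longrightarrow> e \<in> edges \<pi> \<Longrightarrow> vs ! i \<in># bd \<pi> e \<Longrightarrow> weight \<pi> e = \<mu>' ! i"
    using assms(2) by (auto simp: has_profile_def)
  have "map (\<lambda>v. \<Prod>e | e \<in> edges \<pi> \<and> v \<in># bd \<pi> e. weight \<pi> e) vs = \<mu>'"
  proof (rule nth_equalityI)
    fix i assume "i < length (map (\<lambda>v. \<Prod>e | e \<in> edges \<pi> \<and> v \<in># bd \<pi> e. weight \<pi> e) vs)"
    then have i: "i < length \<mu>'" using vs by simp
    then have "vs ! i \<in> leaves \<pi>" using vs by (metis nth_mem subsetD)
    then obtain e where e: "{e \<in> edges \<pi>. vs ! i \<in># bd \<pi> e} = {e}"
      using incident_leaf[OF assms(1)] by blast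
    then have "weight \<pi> e = \<mu>' ! i" by (intro w i) auto
    then show "map (\<lambda>v. \<Prod>e | e \<in> edges \<pi> \<and> v \<in># bd \<pi> e. weight \<pi> e) vs ! i = \<mu>' ! i"
      using i vs e by simp
  qed (simp add: vs)
  then show ?thesis by (simp only: prod.distinct_set_conv_list[OF vs(1)])
qed

text \<open>Each part of mu and nu is the weight of the edge at its leaf, so the denominator
  contains the weight w of an edge once for every leaf on it. The quotient is w, 1 or 1 / w for an
  edge with 0, 1 or 2 leaves.\<close>

lemma prod_weights_eq:
  assumes "\<pi> \<in> covers"
  shows "(\<Prod>e\<in>edges \<pi>. of_nat (weight \<pi> e)) / (of_nat (prod_list \<mu>) * of_nat (prod_list \<nu>)) =
    (\<Prod>e\<in>bounded_edges \<pi>. of_nat (weight \<pi> e) :: complex) / (\<Prod>e\<in>strands \<pi>. of_nat (weight \<pi> e))"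
proof -
  let ?w = "\<lambda>e. of_nat (weight \<pi> e) :: complex"
  let ?d = "\<lambda>e. card {v \<in> leaves \<pi>. v \<in># bd \<pi> e}"
  note lay = layered_covers[OF assms] and lv = covers_leaves[OF assms]
  have fin: "finite (edges \<pi>)" "finite (leaves \<pi>)"
    using assms by (simp_all add: leaky_covers_def is_tropical_cover_def is_tropical_curve_def)
  have disj: "set (left_leaves \<pi>) \<inter> set (right_leaves \<pi>) = {}" by (auto simp: lv(2,5))
  have profiles: "has_profile \<pi> (-\<infinity>) (left_leaves \<pi>) \<mu>" "has_profile \<pi> \<infinity> (right_leaves \<pi>) \<nu>"
    using assms by (simp_all add: leaky_covers_def)
  have "prod_list \<mu> * prod_list \<nu> = (\<Prod>v\<in>leaves \<pi>. \<Prod>e | e \<in> edges \<pi> \<and> v \<in># bd \<pi> e. weight \<pi> e)"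
    unfolding lv(7) prod_leaf_weights[OF assms profiles(1), symmetric] prod_leaf_weights[OF assms profiles(2), symmetric]
    by (simp add: prod.union_disjoint[OF _ _ disj])
  \<comment> \<open>The product over incident pairs of a leaf and an edge is now read edge by
    edge.\<close>
  also have "\<dots> = (\<Prod>e\<in>edges \<pi>. \<Prod>v | v \<in> leaves \<pi> \<and> v \<in># bd \<pi> e. weight \<pi> e)"
    by (rule prod.swap_restrict[OF fin(2,1)])
  also have "\<dots> = (\<Prod>e\<in>edges \<pi>. weight \<pi> e ^ ?d e)" by simp
  finally have \<mu>\<nu>: "of_nat (prod_list \<mu>) * of_nat (prod_list \<nu>) = (\<Prod>e\<in>edges \<pi>. ?w e ^ ?d e)"
    by (simp flip: of_nat_mult of_nat_power of_nat_prod)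
  have "?w e / ?w e ^ ?d e = (if e \<in> bounded_edges \<pi> then ?w e else 1) / (if e \<in> strands \<pi> then ?w e else 1)"
    if e: "e \<in> edges \<pi>" for e
    using keyE[OF lay e]
  proof cases
    case (1 a b)
    let ?u = "vlist ps \<pi> ! a" and ?v = "vlist ps \<pi> ! b"
    have "?u \<noteq> ?v" using 1 assms by (simp add: nth_eq_iff_index_eq distinct_vlist length_vlist)
    moreover have "{v \<in> leaves \<pi>. v \<in># bd \<pi> e} = {?u, ?v} \<inter> leaves \<pi>" using 1 by auto
    ultimately have "?d e = (if ?u \<in> leaves \<pi> then 1 else 0) + (if ?v \<in> leaves \<pi> then 1 else 0)"
      by (auto simp: Int_insert_left)
    moreover have "e \<in> bounded_edges \<pi> \<longleftrightarrow> ?u \<notin> leaves \<pi> \<and> ?v \<notin> leaves \<pi>"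
      "e \<in> strands \<pi> \<longleftrightarrow> ?u \<in> leaves \<pi> \<and> ?v \<in> leaves \<pi>"
      using 1 e by (auto simp: bounded_edges_def ends_def strands_def)
    ultimately show ?thesis using 1 by (auto simp: power2_eq_square)
  qed
  then have "(\<Prod>e\<in>edges \<pi>. ?w e / ?w e ^ ?d e) =
      (\<Prod>e\<in>edges \<pi>. (if e \<in> bounded_edges \<pi> then ?w e else 1) / (if e \<in> strands \<pi> then ?w e else 1))"
    by (rule prod.cong[OF refl])
  moreover have "(\<Prod>e\<in>edges \<pi>. if e \<in> A then ?w e else 1) = (\<Prod>e\<in>A. ?w e)" if "A \<subseteq> edges \<pi>" for A
    using fin(1) that by (simp add: prod.inter_restrict[symmetric] Int_absorb1)
  moreover have "bounded_edges \<pi> \<subseteq> edges \<pi>" "strands \<pi> \<subseteq> edges \<pi>"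
    by (auto simp: bounded_edges_def strands_def)
  ultimately show ?thesis
    unfolding \<mu>\<nu> by (simp add: prod_dividef)
qed

lemma prod_node_coef:
  assumes "\<pi> \<in> covers"
  shows "(\<Prod>a<M. node_coef (nodes ! a) (out_at (code \<pi>) a) (in_at (code \<pi>) a)) =
    (\<Prod>i<length ps. vertex_multiplicity (rs ! i) \<pi> (vertex_over \<pi> (ps ! i)))"
proof -
  have "node_coef (nodes ! (length \<mu> + i)) (out_at (code \<pi>) (length \<mu> + i)) (in_at (code \<pi>) (length \<mu> + i)) =
      vertex_multiplicity (rs ! i) \<pi> (vertex_over \<pi> (ps ! i))" if "i < length ps" for i
    using at_vertex[OF assms that] by (simp add: nodes_nth(2)[OF that] vertex_multiplicity_def)
  then show ?thesis
    unfolding M_def prod_lessThan_add by (simp add: nodes_nth)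
qed

lemma code_image: "code ` covers = admissible nodes"
proof (intro equalityI subsetI)
  fix N assume N: "N \<in> admissible nodes"
  obtain xs where "N = mset xs" by (metis ex_mset)
  then show "N \<in> code ` covers"
    using N cover_of_in_covers code_cover_of by (metis image_eqI)
qed (use code_admissible in blast)

text \<open>Codes are complete invariants by \<open>isomorphic_covers_iff\<close>, and every
  admissible code occurs by \<open>code_image\<close>, so the sum over classes is the sum over
  admissible codes.\<close>

theorem leaky_hurwitz_eq_sum_classes:
  "leaky_hurwitz g \<mu> \<nu> ks rs =
    (\<Sum>X\<in>leaky_cover_classes ps g \<mu> \<nu> ks rs.
       let \<pi> = (SOME \<pi>. \<pi> \<in> X) in
         1 / of_nat (card (Aut \<pi>)) *
         (\<Prod>i<length ps. vertex_multiplicity (rs ! i) \<pi> (vertex_over \<pi> (ps ! i))) *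
         ((\<Prod>e\<in>bounded_edges \<pi>. of_nat (weight \<pi> e)) / (\<Prod>e\<in>strands \<pi>. of_nat (weight \<pi> e))))"
proof -
  define f where "f N = (\<Prod>a<length nodes. node_coef (nodes ! a) (out_at N a) (in_at N a)) *
    ((\<Prod>(a, b, w)\<in>#N. of_nat w) / (of_nat (prod_list \<mu>) * of_nat (prod_list \<nu>))) / of_nat (mfact N)" for N
  have f: "f (code \<pi>) = 1 / of_nat (card (Aut \<pi>)) *
         (\<Prod>i<length ps. vertex_multiplicity (rs ! i) \<pi> (vertex_over \<pi> (ps ! i))) *
         ((\<Prod>e\<in>bounded_edges \<pi>. of_nat (weight \<pi> e)) / (\<Prod>e\<in>strands \<pi>. of_nat (weight \<pi> e)))"
    if "\<pi> \<in> covers" for \<pi>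
    unfolding f_def length_nodes prod_node_coef[OF that] prod_weights_code[OF layered_covers[OF that]]
      prod_weights_eq[OF that] card_Aut[OF that] by simp
  have some: "(SOME \<pi>. \<pi> \<in> X) \<in> covers" if X: "X \<in> leaky_cover_classes ps g \<mu> \<nu> ks rs" for X
  proof -
    obtain \<pi> where \<pi>: "\<pi> \<in> covers" "X = Restr isomorphic_covers covers `` {\<pi>}"
      using X unfolding leaky_cover_classes_def by (rule quotientE)
    then have "\<pi> \<in> X" using isomorphic_covers_iff[OF \<pi>(1,1)] by auto
    then have "(SOME \<pi>. \<pi> \<in> X) \<in> X" by (rule someI)
    then show ?thesis using \<pi> by auto
  qed
  have "leaky_hurwitz g \<mu> \<nu> ks rs = (\<Sum>N\<in>code ` covers. f N)"
    unfolding code_image f_def by (rule leaky_hurwitz_eq_sum[OF nodes_ok])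
  also have "\<dots> = (\<Sum>X\<in>leaky_cover_classes ps g \<mu> \<nu> ks rs. f (code (SOME \<pi>. \<pi> \<in> X)))"
    unfolding leaky_cover_classes_def by (rule sum_classes[symmetric]) (rule isomorphic_covers_iff)
  also have "\<dots> = (\<Sum>X\<in>leaky_cover_classes ps g \<mu> \<nu> ks rs.
       let \<pi> = (SOME \<pi>. \<pi> \<in> X) in
         1 / of_nat (card (Aut \<pi>)) *
         (\<Prod>i<length ps. vertex_multiplicity (rs ! i) \<pi> (vertex_over \<pi> (ps ! i))) *
         ((\<Prod>e\<in>bounded_edges \<pi>. of_nat (weight \<pi> e)) / (\<Prod>e\<in>strands \<pi>. of_nat (weight \<pi> e))))"
    by (intro sum.cong refl) (simp only: f[OF some] Let_def)
  finally show ?thesis .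
qed

end

theorem theorem2p25:
  fixes g s :: nat and \<mu> \<nu> rs :: "nat list" and ks :: "int list" and ps :: "real list"
  assumes "is_partition \<mu>" and "is_partition \<nu>"
    and "s > 0" and "length ks = s" and "length rs = s" and "\<forall>r\<in>set rs. r > 0"
    and "length ps = s" and "sorted_wrt (<) ps"
    and "(\<Sum>i<s. int (rs ! i) - 1) = 2 * int g - 2 + int (length \<mu>) + int (length \<nu>)"
    and "int (\<Sum>i<length \<mu>. \<mu> ! i) = int (\<Sum>j<length \<nu>. \<nu> ! j) + (\<Sum>l<s. ks ! l)"
  shows "leaky_hurwitz g \<mu> \<nu> ks rs =
    (\<Sum>X\<in>leaky_cover_classes ps g \<mu> \<nu> ks rs.
       let \<pi> = (SOME \<pi>. \<pi> \<in> X) in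
         1 / of_nat (card (Aut \<pi>)) *
         (\<Prod>i<s. vertex_multiplicity (rs ! i) \<pi> (vertex_over \<pi> (ps ! i))) *
         ((\<Prod>e\<in>bounded_edges \<pi>. of_nat (weight \<pi> e)) / (\<Prod>e\<in>strands \<pi>. of_nat (weight \<pi> e))))"
proof -
  interpret cover_problem \<mu> \<nu> rs ks ps g
    using assms by unfold_locales (simp_all add: is_partition_def)
  show ?thesis
    using leaky_hurwitz_eq_sum_classes by (simp only: assms(7))
qed

end
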